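(* Let $(X,T)$ be a linearly recurrent minimal Cantor system given by a nested sequence of CKR partitions $(\mathcal P(n))_{n\ge 0}$ satisfying (KR1)–(KR6) and (LR), with associated matrices $(M(n))_{n\ge1}$, and let $\mu$ be its unique $T$-invariant probability measure. Let $\alpha\in\mathbb R$ and $\lambda=\exp(2i\pi\alpha)$. (1) $\lambda$ is an eigenvalue of $(X,T)$ with respect to $\mu$ if and only if $\sum_{n\ge2}|\!|\!|\alpha P(n)H(1)|\!|\!|^2<\infty$. (2) $\lambda$ is a continuous eigenvalue of $(X,T)$ if and only if $\sum_{n\ge2}|\!|\!|\alpha P(n)H(1)|\!|\!|<\infty$.
   Context: A minimal Cantor system $(X,T)$: $X$ is a Cantor space, $T:X\to X$ a homeomorphism all of whose orbits are dense. A clopen Kakutani–Rohlin (CKR) partition is a partition $\{T^{-j}B_k:1\le k\le C,\ 0\le j<h_k\}$ of $X$ with $B_k$ clopen and $h_k\ge1$ integers. Consider a sequence of CKR partitions $\mathcal P(n)=\{T^{-j}B_k(n):1\le k\le C(n),0\le j<h_k(n)\}$, $n\ge0$, with $\mathcal P(0)$ trivial ($C(0)=1$, $B_1(0)=X$, $h_1(0)=1$); roof $B(n)=\bigcup_kB_k(n)$, $k$-th tower $\mathcal T_k(n)=\bigcup_{0\le j<h_k(n)}T^{-j}B_k(n)$. Conditions: (KR1) $B(n+1)\subseteq B(n)$; (KR2) every atom of $\mathcal P(n+1)$ is contained in an atom of $\mathcal P(n)$; (KR3) $\bigcap_nB(n)$ is a single point; (KR4) the partitions together generate the topology of $X$;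 (KR5) for all $n\ge1$, $1\le k\le C(n-1)$, $1\le l\le C(n)$ there is $0\le j<h_l(n)$ with $T^{-j}B_l(n)\subseteq B_k(n-1)$; (KR6) $B(n)\subseteq B_1(n-1)$ for all $n\ge1$. The matrix $M(n)$ ($n\ge1$) is the $C(n)\times C(n-1)$ matrix with entries $m_{l,k}(n)=\#\{0\le j<h_l(n):T^{-j}B_l(n)\subseteq B_k(n-1)\}$. $H(n)=(h_1(n),\dots,h_{C(n)}(n))^T$, so $H(n)=M(n)H(n-1)$ and $H(1)=M(1)$. For $n>m\ge0$, $P(n,m)=M(n)M(n-1)\cdots M(m+1)$, $P(n)=P(n,1)$. (LR): there is $L$ with $h_l(n)\le L\,h_k(n-1)$ for all $n\ge1$, $l\le C(n)$, $k\le C(n-1)$. A minimal Cantor system is linearly recurrent if it admits such a sequence satisfying (KR1)–(KR6) and (LR); such systems are uniquely ergodic. For $x\in\mathbb R$, $|\!|\!|x|\!|\!|$ is the distance from $x$ to the nearest integer; for $V=(v_1,\dots,v_m)^T$, $|\!|\!|V|\!|\!|=\max_j|\!|\!|v_j|\!|\!|$. $\lambda$ is an eigenvalue w.r.t. $\mu$ if $f\circ T=\lambda f$ for some nonzero $f\in L^2(\mu)$; a continuous eigenvalue if such $f$ can be taken continuous. *)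

theory Defs
  imports "HOL-Probability.Probability"
begin

definition cantor_space :: "'a::metric_space set \<Rightarrow> bool" where
  "cantor_space X \<longleftrightarrow> X \<noteq> {} \<and> compact X \<and> (\<forall>x\<in>X. x islimpt X)
     \<and> (\<forall>x\<in>X. connected_component_set X x = {x})"

definition orbit :: "('a \<Rightarrow> 'a) \<Rightarrow> ('a \<Rightarrow> 'a) \<Rightarrow> 'a \<Rightarrow> 'a set" where
  "orbit T Ti x = {(T ^^ n) x | n. True} \<union> {(Ti ^^ n) x | n. True}"

definition minimal_cantor_system :: "'a::metric_space set \<Rightarrow> ('a \<Rightarrow> 'a) \<Rightarrow> ('a \<Rightarrow> 'a) \<Rightarrow> bool" where
  "minimal_cantor_system X T Ti \<longleftrightarrow> cantor_space X \<and> homeomorphism X X T Ti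
     \<and> (\<forall>x\<in>X. X \<subseteq> closure (orbit T Ti x))"

definition preim :: "'a set \<Rightarrow> ('a \<Rightarrow> 'a) \<Rightarrow> nat \<Rightarrow> 'a set \<Rightarrow> 'a set" where
  "preim X T j A = {x \<in> X. (T ^^ j) x \<in> A}"

text \<open>A partition at level n is given by C n (number of towers), the bases B n k
  (k = 1..C n) and heights h n k.\<close>

definition atoms :: "'a set \<Rightarrow> ('a \<Rightarrow> 'a) \<Rightarrow> (nat \<Rightarrow> nat) \<Rightarrow> (nat \<Rightarrow> nat \<Rightarrow> 'a set)
    \<Rightarrow> (nat \<Rightarrow> nat \<Rightarrow> nat) \<Rightarrow> nat \<Rightarrow> 'a set set" where
  "atoms X T C B h n = {preim X T j (B n k) | k j. k \<in> {1..C n} \<and> j < h n k}"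

definition roof :: "(nat \<Rightarrow> nat) \<Rightarrow> (nat \<Rightarrow> nat \<Rightarrow> 'a set) \<Rightarrow> nat \<Rightarrow> 'a set" where
  "roof C B n = (\<Union>k\<in>{1..C n}. B n k)"

definition is_CKR_partition :: "'a::metric_space set \<Rightarrow> ('a \<Rightarrow> 'a) \<Rightarrow> (nat \<Rightarrow> nat)
    \<Rightarrow> (nat \<Rightarrow> nat \<Rightarrow> 'a set) \<Rightarrow> (nat \<Rightarrow> nat \<Rightarrow> nat) \<Rightarrow> nat \<Rightarrow> bool" where
  "is_CKR_partition X T C B h n \<longleftrightarrow>
     C n \<ge> 1
   \<and> (\<forall>k\<in>{1..C n}. B n k \<subseteq> X \<and> B n k \<noteq> {} \<and> h n k \<ge> 1
        \<and> openin (top_of_set X) (B n k) \<and> closedin (top_of_set X) (B n k))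
   \<and> (\<forall>k\<in>{1..C n}. \<forall>j<h n k. \<forall>k'\<in>{1..C n}. \<forall>j'<h n k'. (k, j) \<noteq> (k', j') \<longrightarrow>
        preim X T j (B n k) \<inter> preim X T j' (B n k') = {})
   \<and> \<Union>(atoms X T C B h n) = X"

definition KR_sequence :: "'a::metric_space set \<Rightarrow> ('a \<Rightarrow> 'a) \<Rightarrow> (nat \<Rightarrow> nat)
    \<Rightarrow> (nat \<Rightarrow> nat \<Rightarrow> 'a set) \<Rightarrow> (nat \<Rightarrow> nat \<Rightarrow> nat) \<Rightarrow> bool" where
  "KR_sequence X T C B h \<longleftrightarrow>
     (\<forall>n. is_CKR_partition X T C B h n)
   \<and> C 0 = 1 \<and> B 0 1 = X \<and> h 0 1 = 1
   \<comment> \<open>(KR1)\<close>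
   \<and> (\<forall>n. roof C B (Suc n) \<subseteq> roof C B n)
   \<comment> \<open>(KR2)\<close>
   \<and> (\<forall>n. \<forall>A\<in>atoms X T C B h (Suc n). \<exists>A'\<in>atoms X T C B h n. A \<subseteq> A')
   \<comment> \<open>(KR3)\<close>
   \<and> (\<exists>x. (\<Inter>n. roof C B n) = {x})
   \<comment> \<open>(KR4)\<close>
   \<and> top_of_set X = topology_generated_by (\<Union>n. atoms X T C B h n)
   \<comment> \<open>(KR5)\<close>
   \<and> (\<forall>n\<ge>1. \<forall>k\<in>{1..C (n - 1)}. \<forall>l\<in>{1..C n}. \<exists>j<h n l. preim X T j (B n l) \<subseteq> B (n - 1) k)
   \<comment> \<open>(KR6)\<close>
   \<and> (\<forall>n\<ge>1. roof C B n \<subseteq> B (n - 1) 1)"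

definition linearly_recurrent_seq :: "(nat \<Rightarrow> nat) \<Rightarrow> (nat \<Rightarrow> nat \<Rightarrow> nat) \<Rightarrow> bool" where
  "linearly_recurrent_seq C h \<longleftrightarrow>
     (\<exists>L::real. \<forall>n\<ge>1. \<forall>l\<in>{1..C n}. \<forall>k\<in>{1..C (n - 1)}. real (h n l) \<le> L * real (h (n - 1) k))"

section \<open>Matrices (indices start at 1; a matrix is a function of (row, column))\<close>

definition Mmat :: "'a set \<Rightarrow> ('a \<Rightarrow> 'a) \<Rightarrow> (nat \<Rightarrow> nat \<Rightarrow> 'a set) \<Rightarrow> (nat \<Rightarrow> nat \<Rightarrow> nat)
    \<Rightarrow> nat \<Rightarrow> nat \<Rightarrow> nat \<Rightarrow> real" where
  "Mmat X T B h n l k = real (card {j. j < h n l \<and> preim X T j (B n l) \<subseteq> B (n - 1) k})"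

definition matmul :: "(nat \<Rightarrow> nat \<Rightarrow> real) \<Rightarrow> nat \<Rightarrow> (nat \<Rightarrow> nat \<Rightarrow> real) \<Rightarrow> nat \<Rightarrow> nat \<Rightarrow> real" where
  "matmul A d D i j = (\<Sum>r\<in>{1..d}. A i r * D r j)"

fun Pmat :: "'a set \<Rightarrow> ('a \<Rightarrow> 'a) \<Rightarrow> (nat \<Rightarrow> nat) \<Rightarrow> (nat \<Rightarrow> nat \<Rightarrow> 'a set) \<Rightarrow> (nat \<Rightarrow> nat \<Rightarrow> nat)
    \<Rightarrow> nat \<Rightarrow> nat \<Rightarrow> nat \<Rightarrow> nat \<Rightarrow> real" where
  "Pmat X T C B h 0 m = (\<lambda>i j. if i = j then 1 else 0)"
| "Pmat X T C B h (Suc n) m =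
     (if Suc n \<le> m then (\<lambda>i j. if i = j then 1 else 0)
      else matmul (Mmat X T B h (Suc n)) (C n) (Pmat X T C B h n m))"

definition PH1 :: "'a set \<Rightarrow> ('a \<Rightarrow> 'a) \<Rightarrow> (nat \<Rightarrow> nat) \<Rightarrow> (nat \<Rightarrow> nat \<Rightarrow> 'a set) \<Rightarrow> (nat \<Rightarrow> nat \<Rightarrow> nat)
    \<Rightarrow> nat \<Rightarrow> nat \<Rightarrow> real" where
  "PH1 X T C B h n l = (\<Sum>k\<in>{1..C 1}. Pmat X T C B h n 1 l k * real (h 1 k))"

definition dnint :: "real \<Rightarrow> real" where
  "dnint x = \<bar>x - of_int (round x)\<bar>"

definition vnorm :: "nat \<Rightarrow> (nat \<Rightarrow> real) \<Rightarrow> real" where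
  "vnorm d v = Max ((\<lambda>i. dnint (v i)) ` {1..d})"

definition invariant_prob :: "'a::metric_space set \<Rightarrow> ('a \<Rightarrow> 'a) \<Rightarrow> 'a measure \<Rightarrow> bool" where
  "invariant_prob X T \<mu> \<longleftrightarrow> sets \<mu> = sets (restrict_space borel X) \<and> prob_space \<mu>
     \<and> T \<in> measurable \<mu> \<mu> \<and> (\<forall>A\<in>sets \<mu>. emeasure \<mu> (T -` A \<inter> space \<mu>) = emeasure \<mu> A)"

definition L2_eigenvalue :: "'a measure \<Rightarrow> ('a \<Rightarrow> 'a) \<Rightarrow> complex \<Rightarrow> bool" where
  "L2_eigenvalue \<mu> T c \<longleftrightarrow> (\<exists>f::'a \<Rightarrow> complex. f \<in> borel_measurable \<mu>
      \<and> integrable \<mu> (\<lambda>x. (cmod (f x))\<^sup>2) \<and> \<not> (AE x in \<mu>. f x = 0)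
      \<and> (AE x in \<mu>. f (T x) = c * f x))"

definition continuous_eigenvalue :: "'a::metric_space set \<Rightarrow> 'a measure \<Rightarrow> ('a \<Rightarrow> 'a) \<Rightarrow> complex \<Rightarrow> bool" where
  "continuous_eigenvalue X \<mu> T c \<longleftrightarrow> (\<exists>f::'a \<Rightarrow> complex. continuous_on X f
      \<and> f \<in> borel_measurable \<mu>
      \<and> integrable \<mu> (\<lambda>x. (cmod (f x))\<^sup>2) \<and> \<not> (AE x in \<mu>. f x = 0)
      \<and> (AE x in \<mu>. f (T x) = c * f x))"

end

theory Submission
  imports Defs
begin

text \<open>Write \<open>r\<^sub>n(x)\<close> for the time \<open>x\<close> needs to reach the roof of level \<open>n\<close>, and \<open>V\<^sub>n\<close> for the
  distance of \<open>\<alpha> H(n)\<close> to the integer vectors. The difference \<open>r\<^bsub>n+1\<^esub> - r\<^sub>n\<close> is a sum of at most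
  \<open>L\<close> heights of level \<open>n\<close>, so \<open>\<alpha> (r\<^bsub>n+1\<^esub> - r\<^sub>n)\<close> is within \<open>L V\<^sub>n\<close> of an integer.

  Continuous eigenvalues: if \<open>V\<close> is summable, the functions \<open>\<lambda>\<^bsup>-r\<^sub>n\<^esup>\<close> converge uniformly to an
  eigenfunction. Conversely, for each \<open>n\<close> there is a time \<open>e\<^sub>n\<close> with
  \<open>T\<^bsup>-e\<^sub>n\<^esup> B(n+2) \<subseteq> B(n)\<close> and \<open>\<alpha> e\<^sub>n\<close> at distance at least \<open>V\<^sub>n/2\<close> from the integers. Summing
  the \<open>e\<^sub>n\<close> over those \<open>n\<close> of a given parity whose residues have a given sign gives return times
  to small neighbourhoods of one point, so continuity bounds the sums of the residues.

  Measurable eigenvalues: the centred residues of \<open>\<alpha> (r\<^bsub>n+1\<^esub> - r\<^sub>n)\<close> have exponentially decaying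
  correlations, because passing from tower averages of one level to those of the next is a
  stochastic matrix with entries at least \<open>1/L\<close>. If \<open>V\<close> is square summable, their sum therefore
  converges in \<open>L\<^sup>2\<close>, and normalised \<open>\<lambda>\<^bsup>-r\<^sub>n\<^esup>\<close> converge along a subsequence. Conversely, the
  conditional expectations of an eigenfunction on the partitions form a martingale with square
  summable increments, and these increments dominate \<open>V\<^sub>n\<close>.\<close>

section \<open>Distance to the integers and towers\<close>

lemma dnint_nonneg: "0 \<le> dnint x" by (simp add: dnint_def)

lemma dnint_le: "dnint x \<le> \<bar>x - of_int z\<bar>"
  unfolding dnint_def using round_diff_minimal[of x z] by simp

lemma dnint_triangle: "dnint (x + y) \<le> dnint x + dnint y"
  using dnint_le[of "x + y" "round x + round y"] unfolding dnint_def by simp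

lemma dnint_uminus: "dnint (- x) = dnint x"
proof -
  have "dnint (- y) \<le> dnint y" for y
    using dnint_le[of "- y" "- round y"] unfolding dnint_def by simp
  from this[of x] this[of "- x"] show ?thesis by simp
qed

lemma dnint_le_half: "dnint x \<le> 1 / 2"
  unfolding dnint_def using of_int_round_abs_le[of x] by (simp add: abs_minus_commute)

section \<open>The circle character and its comparison with the distance to the integers\<close>

definition unit_char :: "real \<Rightarrow> complex" where
  "unit_char t = cis (2 * pi * t)"

lemma unit_char_add: "unit_char (s + t) = unit_char s * unit_char t"
  by (simp add: unit_char_def cis_mult ring_distribs)

lemma unit_char_0 [simp]: "unit_char 0 = 1"
  by (simp add: unit_char_def)

lemma norm_unit_char [simp]: "norm (unit_char t) = 1"
  by (simp add: unit_char_def)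

lemma unit_char_nonzero [simp]: "unit_char t \<noteq> 0"
  by (simp add: unit_char_def)

lemma unit_char_int [simp]: "unit_char (of_int z) = 1"
  using cis_multiple_2pi[of "of_int z"] by (simp add: unit_char_def)

lemma unit_char_uminus: "unit_char (- t) = inverse (unit_char t)"
  by (simp add: unit_char_def flip: cis_inverse)

lemma unit_char_diff_round: "unit_char (t - of_int (round t)) = unit_char t"
  using unit_char_add[of "t - of_int (round t)" "of_int (round t)"] by simp

lemma norm_cis_minus_one: "norm (cis t - 1) = 2 * \<bar>sin (t / 2)\<bar>"
proof -
  have "(norm (cis t - 1))\<^sup>2 = (cos t - 1)\<^sup>2 + (sin t)\<^sup>2"
    by (simp add: cmod_power2)
  also have "\<dots> = 2 - 2 * cos t"
    using sin_cos_squared_add[of t] by (simp add: power2_eq_square algebra_simps)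
  also have "\<dots> = (2 * \<bar>sin (t / 2)\<bar>)\<^sup>2"
    using cos_double_sin[of "t/2"] by (simp add: power_mult_distrib)
  finally show ?thesis by (rule power2_eq_imp_eq) auto
qed

lemma norm_unit_char_minus_one_le: "norm (unit_char t - 1) \<le> 2 * pi * dnint t"
proof -
  let ?u = "t - of_int (round t)"
  have "norm (unit_char t - 1) = 2 * \<bar>sin (pi * ?u)\<bar>"
    unfolding unit_char_diff_round[of t, symmetric] unfolding unit_char_def
    by (subst norm_cis_minus_one) simp
  also have "\<dots> \<le> 2 * \<bar>pi * ?u\<bar>" using abs_sin_x_le_abs_x[of "pi * ?u"] by simp
  finally show ?thesis by (simp add: dnint_def abs_mult)
qed

text \<open>The Taylor remainder gives sin x \<ge> x - x^3 / 6, and x \<le> pi / 2 \<le> 1.6 gives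
  x^2 \<le> 2.56 < 3, so at most half of x is lost.\<close>

lemma sin_ge_half:
  fixes x :: real assumes "0 \<le> x" "x \<le> pi / 2" shows "x / 2 \<le> sin x"
proof -
  have x2: "x \<le> 1.6" using assms pi_less_4 pi_approx by simp
  have "\<bar>sin x - (\<Sum>m<3. sin_coeff m * x ^ m)\<bar> \<le> inverse (fact 3) * \<bar>x\<bar> ^ 3"
    by (rule Maclaurin_sin_bound)
  moreover have "(\<Sum>m<3. sin_coeff m * x ^ m) = x"
    by (simp add: sin_coeff_def eval_nat_numeral)
  ultimately have "\<bar>sin x - x\<bar> \<le> x ^ 3 / 6"
    using assms by (simp add: fact_numeral field_simps)
  hence "x - x ^ 3 / 6 \<le> sin x" by linarith
  moreover have "x * x\<^sup>2 \<le> x * (1.6)\<^sup>2"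
    using x2 assms by (intro mult_left_mono power_mono) auto
  hence "x ^ 3 \<le> 3 * x" using assms by (simp add: power3_eq_cube power2_eq_square)
  ultimately show ?thesis by simp
qed

text \<open>The norm equals 2 sin (pi \<open>dnint t\<close>) with an argument in [0, pi/2], where
  \<open>sin_ge_half\<close> applies. Together with \<open>norm_unit_char_minus_one_le\<close> it
  makes residues and phase errors comparable.\<close>

lemma dnint_le_norm_unit_char: "dnint t \<le> norm (unit_char t - 1)"
proof -
  let ?u = "t - of_int (round t)"
  have u: "\<bar>?u\<bar> = dnint t" by (simp add: dnint_def)
  have "norm (unit_char t - 1) = 2 * \<bar>sin (pi * ?u)\<bar>"
    unfolding unit_char_diff_round[of t, symmetric] unfolding unit_char_def
    by (subst norm_cis_minus_one) simp
  also have "\<bar>sin (pi * ?u)\<bar> = \<bar>sin (pi * dnint t)\<bar>"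
  proof (cases "?u \<ge> 0")
    case False
    hence "pi * dnint t = - (pi * ?u)" using u by (simp add: algebra_simps)
    thus ?thesis by simp
  qed (use u in simp)
  finally have "norm (unit_char t - 1) = 2 * \<bar>sin (pi * dnint t)\<bar>" .
  moreover have "pi * dnint t / 2 \<le> sin (pi * dnint t)"
    using dnint_le_half[of t] dnint_nonneg[of t] mult_left_mono[of "dnint t" "1/2" pi]
    by (intro sin_ge_half) auto
  moreover have "1 * dnint t \<le> pi * dnint t"
    using pi_gt3 by (intro mult_right_mono dnint_nonneg) simp
  ultimately show ?thesis by simp
qed

section \<open>Addresses of points and the decomposition of towers into lower towers\<close>

locale kr_system =
  fixes X :: "'a::metric_space set" and T Ti :: "'a \<Rightarrow> 'a"
    and C :: "nat \<Rightarrow> nat" and B :: "nat \<Rightarrow> nat \<Rightarrow> 'a set" and h :: "nat \<Rightarrow> nat \<Rightarrow> nat"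
    and L :: real
  assumes minimal: "minimal_cantor_system X T Ti"
    and kr: "KR_sequence X T C B h"
    and L_ge: "2 \<le> L"
    and LR': "\<And>n l k. l \<in> {1..C (Suc n)} \<Longrightarrow> k \<in> {1..C n} \<Longrightarrow>
               real (h (Suc n) l) \<le> L * real (h n k)"
begin

definition idx :: "nat \<Rightarrow> nat set" where
  "idx n = {1..C n}"

abbreviation "atom n k j \<equiv> preim X T j (B n k)"

lemma CKR: "is_CKR_partition X T C B h n"
  using kr by (simp add: KR_sequence_def)

lemma LR: "l \<in> idx (Suc n) \<Longrightarrow> k \<in> idx n \<Longrightarrow> real (h (Suc n) l) \<le> L * real (h n k)"
  using LR' by (simp add: idx_def)

lemma finite_idx [simp]: "finite (idx n)"
  by (simp add: idx_def)

lemma one_idx [simp]: "1 \<in> idx n" and Suc_0_idx [simp]: "Suc 0 \<in> idx n"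
  using CKR[of n] by (auto simp: is_CKR_partition_def idx_def)

lemma idx_nonempty [simp]: "idx n \<noteq> {}"
  using one_idx by blast

lemma
  assumes "k \<in> idx n"
  shows B_sub: "B n k \<subseteq> X" and B_ne: "B n k \<noteq> {}" and h_pos: "0 < h n k"
    and B_open: "openin (top_of_set X) (B n k)"
  using CKR[of n] assms unfolding is_CKR_partition_def idx_def by (auto simp: Suc_le_eq)

lemma B_sub_roof: "k \<in> idx n \<Longrightarrow> B n k \<subseteq> roof C B n"
  by (auto simp: roof_def idx_def)

lemma roofE: assumes "x \<in> roof C B n" obtains k where "k \<in> idx n" "x \<in> B n k"
  using assms by (auto simp: roof_def idx_def)

lemma homeo: "homeomorphism X X T Ti"
  using minimal by (simp add: minimal_cantor_system_def)

lemma T_in: "x \<in> X \<Longrightarrow> T x \<in> X"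
  using homeo by (auto simp: homeomorphism_def)

lemma Ti_in: "x \<in> X \<Longrightarrow> Ti x \<in> X"
  using homeo by (auto simp: homeomorphism_def)

lemma T_Ti: "x \<in> X \<Longrightarrow> T (Ti x) = x" and Ti_T: "x \<in> X \<Longrightarrow> Ti (T x) = x"
  using homeo by (auto simp: homeomorphism_def)

lemma Tn_in: "x \<in> X \<Longrightarrow> (T ^^ j) x \<in> X"
  by (induction j) (auto simp: T_in)

lemma Tn_surj: "y \<in> X \<Longrightarrow> \<exists>x\<in>X. (T ^^ j) x = y"
proof (induction j arbitrary: y)
  case (Suc j)
  from Suc.IH[OF Ti_in[OF Suc.prems]] obtain x where "x \<in> X" "(T ^^ j) x = Ti y" by blast
  thus ?case using T_Ti[OF Suc.prems] by (intro bexI[of _ x]) auto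
qed auto

lemma atom_sub: "atom n k j \<subseteq> X" by (auto simp: preim_def)

lemma atom_0: "k \<in> idx n \<Longrightarrow> atom n k 0 = B n k"
  using B_sub[of k n] by (auto simp: preim_def)

lemma preim_add: "x \<in> X \<Longrightarrow> x \<in> preim X T (i + j) A \<longleftrightarrow> (T ^^ j) x \<in> preim X T i A"
  by (simp add: preim_def Tn_in funpow_add)

lemma preim_nonempty:
  assumes "A \<subseteq> X" "A \<noteq> {}" shows "preim X T j A \<noteq> {}"
proof -
  obtain y where "y \<in> A" using assms(2) by blast
  moreover obtain x where "x \<in> X" "(T ^^ j) x = y" using Tn_surj assms(1) \<open>y \<in> A\<close> by blast
  ultimately have "x \<in> preim X T j A" by (simp add: preim_def)
  thus ?thesis by blast
qed

lemma atom_ne: "k \<in> idx n \<Longrightarrow> atom n k j \<noteq> {}"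
  by (simp add: preim_nonempty B_sub B_ne)

lemma atom_unique:
  assumes "k \<in> idx n" "j < h n k" "k' \<in> idx n" "j' < h n k'" "x \<in> atom n k j" "x \<in> atom n k' j'"
  shows "k = k' \<and> j = j'"
proof (rule ccontr)
  assume "\<not> ?thesis"
  hence "(k, j) \<noteq> (k', j')" by auto
  hence "atom n k j \<inter> atom n k' j' = {}"
    using CKR[of n] assms(1-4) unfolding is_CKR_partition_def idx_def by blast
  with assms(5,6) show False by blast
qed

lemma atom_cover:
  assumes "x \<in> X" obtains k j where "k \<in> idx n" "j < h n k" "x \<in> atom n k j"
proof -
  have "\<Union>(atoms X T C B h n) = X" using CKR[of n] unfolding is_CKR_partition_def by simp
  with assms show ?thesis using that unfolding atoms_def idx_def by blast
qed

text \<open>\<open>tow n x\<close> and \<open>ret n x\<close> are the unique \<open>k\<close> and \<open>j\<close> such that \<open>x\<close> lies in the atom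
  \<open>T\<^bsup>-j\<^esup> B\<^sub>k(n)\<close>; both are junk outside \<open>X\<close>.\<close>

definition tow :: "nat \<Rightarrow> 'a \<Rightarrow> nat" where
  "tow n x = (THE k. k \<in> idx n \<and> (\<exists>j<h n k. x \<in> atom n k j))"

definition ret :: "nat \<Rightarrow> 'a \<Rightarrow> nat" where
  "ret n x = (THE j. \<exists>k\<in>idx n. j < h n k \<and> x \<in> atom n k j)"

lemma address_eq:
  assumes "k \<in> idx n" "j < h n k" "x \<in> atom n k j"
  shows "tow n x = k" "ret n x = j"
proof -
  have u: "k' = k \<and> j' = j" if "k' \<in> idx n" "j' < h n k'" "x \<in> atom n k' j'" for k' j'
    using atom_unique[OF that(1,2) assms(1,2) that(3) assms(3)] .
  show "tow n x = k" unfolding tow_def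
    by (rule the_equality, use assms in blast, use u in blast)
  show "ret n x = j" unfolding ret_def
    by (rule the_equality, use assms in blast, use u in blast)
qed

lemma address:
  assumes "x \<in> X"
  shows "tow n x \<in> idx n" "ret n x < h n (tow n x)" "x \<in> atom n (tow n x) (ret n x)"
proof -
  obtain k j where "k \<in> idx n" "j < h n k" "x \<in> atom n k j" using atom_cover[OF assms] .
  thus "tow n x \<in> idx n" "ret n x < h n (tow n x)" "x \<in> atom n (tow n x) (ret n x)"
    by (simp_all add: address_eq)
qed

lemma roof_ret: "x \<in> roof C B n \<Longrightarrow> ret n x = 0"
  using address_eq(2)[of _ n 0 x] h_pos atom_0 by (blast elim: roofE)

lemma ret_T:
  assumes "x \<in> X" "ret n x \<noteq> 0" shows "ret n (T x) = ret n x - 1"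
proof -
  obtain j where j: "ret n x = Suc j" using assms(2) not0_implies_Suc by blast
  have "T x \<in> atom n (tow n x) j"
    using address(3)[OF assms(1), of n] preim_add[OF assms(1), of j 1] j by simp
  thus ?thesis using address_eq(2)[of "tow n x" n j "T x"] address(1,2)[OF assms(1), of n] j
    by simp
qed

text \<open>If x were not in the roof, T x would lie one floor below x in the same tower. But T x is
  on the top floor of tower k, so x would have return time \<open>h n k\<close>, which no address in
  that tower allows.\<close>

lemma return_roof:
  assumes k: "k \<in> idx n" shows "atom n k (h n k) \<subseteq> roof C B n"
proof
  fix x assume x: "x \<in> atom n k (h n k)"
  hence xX: "x \<in> X" by (simp add: preim_def)
  have hk: "h n k = (h n k - 1) + 1" using h_pos[OF k] by simp
  have Tx: "T x \<in> atom n k (h n k - 1)"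
    using x preim_add[OF xX, of "h n k - 1" 1 "B n k"] hk by simp
  have lt: "h n k - 1 < h n k" using hk by linarith
  have "ret n x = 0"
  proof (rule ccontr)
    assume r: "ret n x \<noteq> 0"
    have "T x \<in> atom n (tow n x) (ret n x - 1)"
      using address(3)[OF xX, of n] preim_add[OF xX, of "ret n x - 1" 1 "B n (tow n x)"] r by simp
    hence "k = tow n x \<and> h n k - 1 = ret n x - 1"
      using atom_unique[OF k lt address(1)[OF xX, of n] less_imp_diff_less[OF address(2)[OF xX]] Tx]
      by blast
    thus False using address(2)[OF xX, of n] r lt by auto
  qed
  thus "x \<in> roof C B n"
    using address(1,3)[OF xX, of n] atom_0[of "tow n x" n] B_sub_roof[of "tow n x" n] by auto
qed

lemma roof_Suc: "roof C B (Suc n) \<subseteq> roof C B n"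
  using kr by (simp add: KR_sequence_def)

lemma roof_mono: "m \<le> n \<Longrightarrow> roof C B n \<subseteq> roof C B m"
  by (rule lift_Suc_antimono_le[of "roof C B"]) (auto simp: roof_Suc)

lemma roof_sub: "roof C B n \<subseteq> X"
  using B_sub by (blast elim: roofE)

lemma roof_Suc_sub_B1: "roof C B (Suc n) \<subseteq> B n 1"
  using kr unfolding KR_sequence_def by (metis One_nat_def diff_Suc_1 le_add1 plus_1_eq_Suc)

lemma atom_refine:
  assumes "l \<in> idx (Suc n)" "j < h (Suc n) l"
  obtains k i where "k \<in> idx n" "i < h n k" "atom (Suc n) l j \<subseteq> atom n k i"
proof -
  have "atom (Suc n) l j \<in> atoms X T C B h (Suc n)" using assms unfolding atoms_def idx_def by blast
  moreover have "\<forall>A\<in>atoms X T C B h (Suc n). \<exists>A'\<in>atoms X T C B h n. A \<subseteq> A'"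
    using kr by (simp add: KR_sequence_def)
  ultimately obtain A' where "A' \<in> atoms X T C B h n" "atom (Suc n) l j \<subseteq> A'" by blast
  thus ?thesis using that unfolding atoms_def idx_def by blast
qed

text \<open>The cardinality is the entry (l, k) of M(n + 1). The positions themselves are kept
  because they determine the phases \<alpha> i.\<close>

definition vis :: "nat \<Rightarrow> nat \<Rightarrow> nat \<Rightarrow> nat set" where
  "vis n l k = {i. i < h (Suc n) l \<and> atom (Suc n) l i \<subseteq> B n k}"

lemma finite_vis [simp]: "finite (vis n l k)"
  by (rule finite_subset[of _ "{..<h (Suc n) l}"]) (auto simp: vis_def)

lemma visD: "i \<in> vis n l k \<Longrightarrow> i < h (Suc n) l" "i \<in> vis n l k \<Longrightarrow> atom (Suc n) l i \<subseteq> B n k"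
  by (auto simp: vis_def)

lemma vis_nonempty: "k \<in> idx n \<Longrightarrow> l \<in> idx (Suc n) \<Longrightarrow> vis n l k \<noteq> {}"
proof -
  assume kl: "k \<in> idx n" "l \<in> idx (Suc n)"
  have "\<forall>n\<ge>1. \<forall>k\<in>{1..C (n - 1)}. \<forall>l\<in>{1..C n}. \<exists>j<h n l. preim X T j (B n l) \<subseteq> B (n - 1) k"
    using kr by (simp add: KR_sequence_def)
  from this[rule_format, of "Suc n" k l] kl show ?thesis by (auto simp: vis_def idx_def)
qed

text \<open>By (KR2) the whole atom lies in one atom of level n, so a single common point decides
  which one.\<close>

lemma visI:
  assumes "l \<in> idx (Suc n)" "i < h (Suc n) l" "k \<in> idx n" "x \<in> atom (Suc n) l i" "x \<in> B n k"
  shows "i \<in> vis n l k"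
proof -
  obtain k' j' where kj: "k' \<in> idx n" "j' < h n k'" "atom (Suc n) l i \<subseteq> atom n k' j'"
    using atom_refine[OF assms(1,2)] .
  have "k' = k \<and> j' = 0"
    using atom_unique[OF kj(1,2) assms(3) h_pos[OF assms(3)], of x] assms(4,5) kj(3)
      atom_0[OF assms(3)] by auto
  thus ?thesis using kj assms atom_0[OF assms(3)] by (auto simp: vis_def)
qed

lemma zero_vis: "l \<in> idx (Suc n) \<Longrightarrow> 0 \<in> vis n l 1"
  using roof_Suc_sub_B1[of n] h_pos[of l "Suc n"] atom_0[of l "Suc n"]
    B_sub_roof[of l "Suc n"] by (auto simp: vis_def)

lemma atom_add_sub:
  assumes "i \<in> vis n l k" shows "atom (Suc n) l (i + j) \<subseteq> atom n k j"
proof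
  fix x assume x: "x \<in> atom (Suc n) l (i + j)"
  hence "x \<in> X" by (simp add: preim_def)
  moreover from preim_add[OF this, of i j] x have "(T ^^ j) x \<in> atom (Suc n) l i" by blast
  ultimately show "x \<in> atom n k j" using visD(2)[OF assms] by (auto simp: preim_def)
qed

text \<open>A block of level n cannot stick out of its tower: the floor just past the top belongs to
  the roof of level n + 1, hence to that of level n, and cannot be a positive floor of a tower of
  level n.\<close>

lemma vis_add_less:
  assumes i: "i \<in> vis n l k" and l: "l \<in> idx (Suc n)" and k: "k \<in> idx n" and j: "j < h n k"
  shows "i + j < h (Suc n) l"
proof (rule ccontr)
  assume c: "\<not> ?thesis"
  define j' where "j' = h (Suc n) l - i"
  have j': "i + j' = h (Suc n) l" "j' \<noteq> 0" "j' \<le> j" using visD(1)[OF i] c by (auto simp: j'_def)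
  obtain x where x: "x \<in> atom (Suc n) l (h (Suc n) l)" using atom_ne[OF l] by blast
  have "x \<in> roof C B n" using return_roof[OF l] roof_Suc x by blast
  hence "ret n x = 0" by (rule roof_ret)
  moreover have "x \<in> atom n k j'" using atom_add_sub[OF i, of j'] x j' by auto
  hence "ret n x = j'" using address_eq(2)[OF k] j' j by auto
  ultimately show False using j' by simp
qed

text \<open>(KR2) supplies the tower k and the floor j'. If j' > j, the base of tower l would sit on
  a positive floor of tower k although it lies in the roof; so j - j' is a position, and it is a
  visit.\<close>

lemma vis_decomp:
  assumes l: "l \<in> idx (Suc n)" and j: "j < h (Suc n) l"
  obtains k i j' where "k \<in> idx n" "i \<in> vis n l k" "j' < h n k" "j = i + j'"
proof -
  obtain k j' where kj: "k \<in> idx n" "j' < h n k" "atom (Suc n) l j \<subseteq> atom n k j'"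
    using atom_refine[OF l j] .
  obtain x where x: "x \<in> atom (Suc n) l j" using atom_ne[OF l] by blast
  have xX: "x \<in> X" using x by (simp add: preim_def)
  have le: "j' \<le> j"
  proof (rule ccontr)
    assume "\<not> ?thesis"
    hence e: "j' = (j' - j) + j" "j' - j \<noteq> 0" "j' - j < h n k" using kj(2) by auto
    have y: "(T ^^ j) x \<in> roof C B n"
      using x B_sub_roof[OF l] roof_Suc[of n] by (auto simp: preim_def)
    have "(T ^^ j) x \<in> atom n k (j' - j)"
      using preim_add[OF xX, of "j' - j" j] e(1) kj(3) x by auto
    from address_eq(2)[OF kj(1) e(3) this] roof_ret[OF y] e(2) show False by simp
  qed
  have "x \<in> atom (Suc n) l ((j - j') + j')" using x le by simp
  hence "(T ^^ j') x \<in> atom (Suc n) l (j - j')"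
    using preim_add[OF xX, of "j - j'" j'] by blast
  moreover have "(T ^^ j') x \<in> B n k" using x kj(3) by (auto simp: preim_def)
  ultimately have "j - j' \<in> vis n l k" using visI[OF l _ kj(1)] j by simp
  thus ?thesis using that[OF kj(1) _ kj(2)] le by simp
qed

text \<open>The floors of a tower of level n + 1 are cut into disjoint blocks, one copy of tower k
  for each visit to its base; (k, i, j) \<mapsto> i + j is the resulting bijection.\<close>

lemma sum_tower:
  fixes F :: "nat \<Rightarrow> 'b::comm_monoid_add"
  assumes l: "l \<in> idx (Suc n)"
  shows "(\<Sum>j<h (Suc n) l. F j) = (\<Sum>k\<in>idx n. \<Sum>i\<in>vis n l k. \<Sum>j<h n k. F (i + j))"
proof -
  let ?D = "SIGMA k:idx n. vis n l k \<times> {..<h n k}"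
  have "inj_on (\<lambda>(k, i, j). i + j) ?D"
  proof (rule inj_onI, clarsimp)
    fix k i j k' i' j'
    assume a: "k \<in> idx n" "i \<in> vis n l k" "j < h n k"
      "k' \<in> idx n" "i' \<in> vis n l k'" "j' < h n k'" "i + j = i' + j'"
    obtain x where x: "x \<in> atom (Suc n) l (i + j)" using atom_ne[OF l] by blast
    have "k = k' \<and> j = j'"
      using atom_unique[of k n j k' j' x] atom_add_sub[OF a(2), of j] atom_add_sub[OF a(5), of j']
        a x by auto
    thus "k = k' \<and> i = i' \<and> j = j'" using a(7) by simp
  qed
  moreover have "(\<lambda>(k, i, j). i + j) ` ?D = {..<h (Suc n) l}"
  proof (intro equalityI subsetI)
    fix j assume "j \<in> {..<h (Suc n) l}"
    then obtain k i j' where "k \<in> idx n" "i \<in> vis n l k" "j' < h n k" "j = i + j'"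
      using vis_decomp[OF l] by blast
    hence "j = (\<lambda>(k, i, j). i + j) (k, i, j')" "(k, i, j') \<in> ?D" by auto
    thus "j \<in> (\<lambda>(k, i, j). i + j) ` ?D" by blast
  qed (use vis_add_less[OF _ l] in auto)
  ultimately have "bij_betw (\<lambda>(k, i, j). i + j) ?D {..<h (Suc n) l}" by (simp add: bij_betw_def)
  hence "(\<Sum>j<h (Suc n) l. F j) = (\<Sum>(k, i, j)\<in>?D. F (i + j))"
    by (subst sum.reindex_bij_betw[symmetric]) (auto intro!: sum.cong)
  also have "\<dots> = (\<Sum>k\<in>idx n. \<Sum>(i, j)\<in>vis n l k \<times> {..<h n k}. F (i + j))"
    by (subst sum.Sigma) (auto intro!: sum.cong)
  also have "\<dots> = (\<Sum>k\<in>idx n. \<Sum>i\<in>vis n l k. \<Sum>j<h n k. F (i + j))"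
    by (subst sum.cartesian_product) auto
  finally show ?thesis .
qed

lemma h_rec:
  assumes "l \<in> idx (Suc n)"
  shows "real (h (Suc n) l) = (\<Sum>k\<in>idx n. real (card (vis n l k)) * real (h n k))"
  using sum_tower[OF assms, of "\<lambda>_. 1::real"] by simp

lemma card_vis_ge: "k \<in> idx n \<Longrightarrow> l \<in> idx (Suc n) \<Longrightarrow> 1 \<le> real (card (vis n l k))"
  using vis_nonempty[of k n l] by (simp add: Suc_le_eq card_gt_0_iff)

text \<open>Both sides satisfy the same recursion H(n + 1) = M(n + 1) H(n), and P(1) is the
  identity. The criteria thus concern the tower heights alone.\<close>

lemma PH1_eq_h: "l \<in> idx (Suc n) \<Longrightarrow> PH1 X T C B h (Suc n) l = real (h (Suc n) l)"
proof (induction n arbitrary: l)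
  case 0
  have "(\<Sum>k=1..C 1. (if l = k then 1 else 0) * real (h (Suc 0) k))
      = (\<Sum>k=1..C 1. if k = l then real (h (Suc 0) k) else 0)"
    by (intro sum.cong) auto
  thus ?case using 0 by (simp add: PH1_def idx_def)
next
  case (Suc n)
  have P: "Pmat X T C B h (Suc (Suc n)) 1 l k
      = (\<Sum>r\<in>idx (Suc n). Mmat X T B h (Suc (Suc n)) l r * Pmat X T C B h (Suc n) 1 r k)" for k
    by (subst Pmat.simps(2)) (simp add: matmul_def idx_def del: Pmat.simps)
  have "PH1 X T C B h (Suc (Suc n)) l = (\<Sum>k=1..C 1. \<Sum>r\<in>idx (Suc n).
      Mmat X T B h (Suc (Suc n)) l r * (Pmat X T C B h (Suc n) 1 r k * real (h 1 k)))"
    unfolding PH1_def P by (simp add: sum_distrib_right mult.assoc del: Pmat.simps)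
  also have "\<dots> = (\<Sum>r\<in>idx (Suc n). Mmat X T B h (Suc (Suc n)) l r * PH1 X T C B h (Suc n) r)"
    by (subst sum.swap) (simp add: PH1_def sum_distrib_left del: Pmat.simps)
  also have "\<dots> = (\<Sum>r\<in>idx (Suc n). real (card (vis (Suc n) l r)) * real (h (Suc n) r))"
    using Suc.IH by (intro sum.cong) (auto simp: Mmat_def vis_def)
  finally show ?case using h_rec[OF Suc.prems] by simp
qed

end

section \<open>Topology of the towers and entrance times\<close>

context kr_system
begin

abbreviation "cell n x \<equiv> atom n (tow n x) (ret n x)"

lemma ret_step:
  assumes "x \<in> X"
  shows "\<exists>i\<in>vis n (tow (Suc n) x) (tow n x). ret (Suc n) x = i + ret n x"
proof -
  obtain k i j where d: "k \<in> idx n" "i \<in> vis n (tow (Suc n) x) k" "j < h n k" "ret (Suc n) x = i + j"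
    using vis_decomp[OF address(1,2)[OF assms]] by blast
  have "x \<in> atom n k j" using atom_add_sub[OF d(2), of j] address(3)[OF assms, of "Suc n"] d(4) by auto
  thus ?thesis using address_eq[OF d(1,3)] d by auto
qed

lemma cell_antimono: assumes "x \<in> X" "m \<le> n" shows "cell n x \<subseteq> cell m x"
  using assms(2)
proof (rule lift_Suc_antimono_le[of "\<lambda>n. cell n x", rotated])
  fix n
  obtain i where "i \<in> vis n (tow (Suc n) x) (tow n x)" "ret (Suc n) x = i + ret n x"
    using ret_step[OF assms(1)] by blast
  thus "cell (Suc n) x \<subseteq> cell n x" using atom_add_sub by metis
qed

text \<open>(KR4) only makes the atoms a subbasis. Since the cells of x decrease with the level, a
  finite intersection of neighbourhoods still contains a cell, so they form a local basis.\<close>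

lemma cell_basis:
  assumes "openin (top_of_set X) U" "x \<in> U"
  shows "\<exists>n. cell n x \<subseteq> U"
proof -
  have "top_of_set X = topology_generated_by (\<Union>n. atoms X T C B h n)"
    using kr by (simp add: KR_sequence_def)
  hence "generate_topology_on (\<Union>n. atoms X T C B h n) U"
    using assms(1) openin_topology_generated_by by metis
  moreover have xX: "x \<in> X" using assms openin_imp_subset by blast
  ultimately show ?thesis using assms(2)
  proof (induction)
    case (Int a b)
    then obtain n m where "cell n x \<subseteq> a" "cell m x \<subseteq> b" by blast
    hence "cell (max n m) x \<subseteq> a \<inter> b"
      using cell_antimono[OF xX, of n "max n m"] cell_antimono[OF xX, of m "max n m"] by auto
    thus ?case by blast
  next
    case (Basis s)
    then obtain n k j where "s = atom n k j" "k \<in> idx n" "j < h n k"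
      unfolding atoms_def idx_def by blast
    thus ?case using address_eq[of k n j x] Basis.prems by (intro exI[of _ n]) auto
  qed blast+
qed

definition x0 :: 'a where "x0 = (THE x. (\<Inter>n. roof C B n) = {x})"

lemma Inter_roof: "(\<Inter>n. roof C B n) = {x0}"
proof -
  have "\<exists>x. (\<Inter>n. roof C B n) = {x}" using kr by (simp add: KR_sequence_def)
  then obtain x where x: "(\<Inter>n. roof C B n) = {x}" ..
  hence "x0 = x" unfolding x0_def by (intro the_equality) auto
  thus ?thesis using x by simp
qed

lemma x0_roof: "x0 \<in> roof C B n" using Inter_roof by auto

lemma x0_in: "x0 \<in> X" using x0_roof roof_sub by blast

text \<open>By (KR6) the roof of level n + 1 lies in \<open>B n 1\<close>, which is exactly the cell
  of \<open>x0\<close> at level n.\<close>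

lemma roof_shrinks:
  assumes "openin (top_of_set X) U" "x0 \<in> U"
  shows "\<exists>n. roof C B n \<subseteq> U"
proof -
  obtain n where n: "cell n x0 \<subseteq> U" using cell_basis[OF assms] by blast
  have "x0 \<in> B n 1" using roof_Suc_sub_B1 x0_roof by blast
  hence "tow n x0 = 1" "ret n x0 = 0"
    using address_eq[OF one_idx h_pos[OF one_idx], of x0 n] atom_0[OF one_idx] by auto
  hence "roof C B (Suc n) \<subseteq> U" using n roof_Suc_sub_B1[of n] atom_0[OF one_idx, of n] by simp
  thus ?thesis by blast
qed

lemma ret_0_imp_roof:
  assumes "x \<in> X" "ret n x = 0" shows "x \<in> roof C B n"
proof -
  have "x \<in> B n (tow n x)"
    using address(3)[OF assms(1), of n] atom_0[OF address(1)[OF assms(1)]] assms(2) by simp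
  thus ?thesis using B_sub_roof[OF address(1)[OF assms(1), of n]] by blast
qed

lemma eventually_ret_T:
  assumes "x \<in> X" "x \<noteq> x0"
  shows "\<forall>\<^sub>F n in sequentially. real (ret n (T x)) = real (ret n x) - 1"
proof -
  obtain N where N: "x \<notin> roof C B N" using Inter_roof assms(2) by blast
  have "real (ret n (T x)) = real (ret n x) - 1" if "N \<le> n" for n
  proof -
    have "ret n x \<noteq> 0" using ret_0_imp_roof[OF assms(1)] roof_mono[OF that] N by blast
    thus ?thesis using ret_T[OF assms(1), of n] by simp
  qed
  thus ?thesis unfolding eventually_sequentially by blast
qed

lemma openin_atom:
  assumes "k \<in> idx n" shows "openin (top_of_set X) (atom n k j)"
proof -
  have "continuous_on X (T ^^ j)"
  proof (induction j)
    case (Suc j)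
    have "continuous_on ((T ^^ j) ` X) T"
      using homeo Tn_in by (auto simp: homeomorphism_def intro: continuous_on_subset)
    from continuous_on_compose[OF Suc this] show ?case by (simp add: comp_def)
  qed (simp add: continuous_on_id)
  hence "openin (top_of_set X) (X \<inter> (T ^^ j) -` B n k)"
    using Tn_in B_open[OF assms] by (intro continuous_openin_preimage[of X _ X]) auto
  thus ?thesis by (simp add: preim_def Int_def vimage_def)
qed

lemma continuous_on_ret:
  fixes g :: "nat \<Rightarrow> 'b::topological_space"
  shows "continuous_on X (\<lambda>x. g (ret n x))"
  unfolding continuous_on_def
proof
  fix x assume x: "x \<in> X"
  obtain U where U: "open U" "cell n x = X \<inter> U"
    using openin_atom[OF address(1)[OF x, of n], of "ret n x"] unfolding openin_open by blast
  have "\<forall>\<^sub>F y in at x within X. g (ret n y) = g (ret n x)"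
    unfolding eventually_at_topological
  proof (intro exI[of _ U] conjI ballI impI)
    fix y assume "y \<in> U" "y \<noteq> x" "y \<in> X"
    hence "y \<in> cell n x" using U by blast
    thus "g (ret n y) = g (ret n x)" using address_eq(2)[OF address(1,2)[OF x]] by simp
  qed (use U address(3)[OF x, of n] in auto)
  thus "((\<lambda>x. g (ret n x)) \<longlongrightarrow> g (ret n x)) (at x within X)" by (rule tendsto_eventually)
qed

text \<open>A period would make the two-sided orbit finite, hence closed; by minimality X would be
  finite, against the absence of isolated points.\<close>

lemma x0_aperiodic:
  assumes "0 < p" shows "(T ^^ p) x0 \<noteq> x0"
proof
  assume p: "(T ^^ p) x0 = x0"
  have inv: "(Ti ^^ j) ((T ^^ j) x) = x" if "x \<in> X" for j x
    using that
  proof (induction j arbitrary: x)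
    case (Suc j)
    have "(Ti ^^ Suc j) ((T ^^ Suc j) x) = (Ti ^^ j) (Ti (T ((T ^^ j) x)))"
      by (simp add: funpow_swap1)
    thus ?case using Suc Ti_T[OF Tn_in[OF Suc.prems]] by simp
  qed simp
  have q: "(Ti ^^ p) x0 = x0" using inv[OF x0_in, of p] p by simp
  have "orbit T Ti x0 \<subseteq> (\<lambda>m. (T ^^ m) x0) ` {..<p} \<union> (\<lambda>m. (Ti ^^ m) x0) ` {..<p}"
    unfolding orbit_def using funpow_mod_eq[OF p] funpow_mod_eq[OF q] assms
    by (auto simp: image_iff) (metis lessThan_iff mod_less_divisor)+
  hence fin: "finite (orbit T Ti x0)" by (rule finite_subset) auto
  hence "X \<subseteq> orbit T Ti x0"
    using minimal x0_in finite_imp_closed[OF fin] unfolding minimal_cantor_system_def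
    by (metis closure_closed)
  hence "finite X" using fin finite_subset by blast
  moreover have "x0 islimpt X"
    using minimal x0_in by (simp add: minimal_cantor_system_def cantor_space_def)
  ultimately show False by (simp add: islimpt_finite)
qed

end

section \<open>Residues of visit times and the approximate eigenfunctions\<close>

locale kr_char = kr_system X T Ti C B h L
  for X :: "'a::metric_space set" and T Ti :: "'a \<Rightarrow> 'a"
    and C :: "nat \<Rightarrow> nat" and B :: "nat \<Rightarrow> nat \<Rightarrow> 'a set" and h :: "nat \<Rightarrow> nat \<Rightarrow> nat"
    and L :: real +
  fixes \<alpha> :: real
begin

definition V :: "nat \<Rightarrow> real" where
  "V n = vnorm (C n) (\<lambda>l. \<alpha> * real (h n l))"

lemma V_ge: "k \<in> idx n \<Longrightarrow> dnint (\<alpha> * real (h n k)) \<le> V n"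
  unfolding V_def vnorm_def idx_def by (intro Max_ge) auto

lemma V_attained: "\<exists>k\<in>idx n. V n = dnint (\<alpha> * real (h n k))"
proof -
  have "V n \<in> (\<lambda>i. dnint (\<alpha> * real (h n i))) ` idx n"
    unfolding V_def vnorm_def idx_def[symmetric] by (intro Max_in) auto
  thus ?thesis by auto
qed

lemma V_nonneg: "0 \<le> V n"
  using V_ge[OF one_idx] dnint_nonneg order_trans by blast

lemma vnorm_PH1: "vnorm (C (n + 2)) (\<lambda>l. \<alpha> * PH1 X T C B h (n + 2) l) = V (n + 2)"
  unfolding V_def vnorm_def using PH1_eq_h[of _ "Suc n"]
  by (intro arg_cong[of _ _ Max] image_cong) (auto simp: idx_def)

text \<open>Position i - 1 lies in some block and must end it: otherwise position i would be a
  positive floor of that block while lying in the roof.\<close>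

lemma vis_pred:
  assumes i: "i \<in> vis n l k" and l: "l \<in> idx (Suc n)" and k: "k \<in> idx n" and pos: "0 < i"
  shows "\<exists>k'\<in>idx n. \<exists>i'\<in>vis n l k'. i = i' + h n k'"
proof -
  have "i - 1 < h (Suc n) l" using visD(1)[OF i] by simp
  then obtain k' i' j where d: "k' \<in> idx n" "i' \<in> vis n l k'" "j < h n k'" "i - 1 = i' + j"
    by (rule vis_decomp[OF l])
  have "Suc j = h n k'"
  proof (rule ccontr)
    assume "Suc j \<noteq> h n k'"
    hence j: "Suc j < h n k'" using d(3) by simp
    obtain x where x: "x \<in> atom (Suc n) l i" using atom_ne[OF l] by blast
    have "i = i' + Suc j" using d(4) pos by simp
    hence "x \<in> atom n k' (Suc j)" using atom_add_sub[OF d(2), of "Suc j"] x by auto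
    hence "ret n x = Suc j" using address_eq(2)[OF d(1) j] by blast
    moreover have "ret n x = 0"
      using x visD(2)[OF i] B_sub_roof[OF k] by (intro roof_ret) blast
    ultimately show False by simp
  qed
  thus ?thesis using d pos by (intro bexI[of _ k'] bexI[of _ i']) auto
qed

text \<open>Position i is reached by stacking blocks, each with residue at most \<open>V n\<close>.
  With c the least height at level n there are at most i / c blocks, and i < L c by linear
  recurrence. The induction carries this count in multiplied form.\<close>

lemma dnint_vis:
  assumes l: "l \<in> idx (Suc n)" and k: "k \<in> idx n" and i: "i \<in> vis n l k"
  shows "dnint (\<alpha> * real i) \<le> L * V n"
proof -
  have "Min (h n ` idx n) \<in> h n ` idx n" by (intro Min_in) auto
  then obtain k0 where k0: "k0 \<in> idx n" "Min (h n ` idx n) = h n k0" by blast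
  let ?c = "real (h n k0)"
  have c: "?c \<le> real (h n k')" if "k' \<in> idx n" for k' unfolding k0(2)[symmetric] using that by auto
  have "?c * dnint (\<alpha> * real i) \<le> V n * real i" using i k
  proof (induction i arbitrary: k rule: less_induct)
    case (less i)
    show ?case
    proof (cases "i = 0")
      case False
      obtain k' i' where d: "k' \<in> idx n" "i' \<in> vis n l k'" "i = i' + h n k'"
        using vis_pred[OF less.prems(1) l less.prems(2)] False by blast
      have "i' < i" using d(3) h_pos[OF d(1)] by simp
      have "dnint (\<alpha> * real i) \<le> dnint (\<alpha> * real i') + dnint (\<alpha> * real (h n k'))"
        using dnint_triangle[of "\<alpha> * real i'"] d(3) by (simp add: ring_distribs)
      hence "?c * dnint (\<alpha> * real i) \<le> ?c * dnint (\<alpha> * real i') + ?c * V n"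
        using V_ge[OF d(1)] by (simp add: mult_left_mono flip: ring_distribs)
      also have "\<dots> \<le> V n * real i' + real (h n k') * V n"
        by (intro add_mono mult_right_mono c d less.IH[OF \<open>i' < i\<close> d(2,1)] V_nonneg)
      finally show ?thesis using d(3) by (simp add: algebra_simps)
    qed (simp add: dnint_def)
  qed
  also have "V n * real i \<le> V n * (L * ?c)"
    using visD(1)[OF i] LR[OF l k0(1)] by (intro mult_left_mono V_nonneg) simp
  finally have "?c * dnint (\<alpha> * real i) \<le> ?c * (L * V n)" by (simp add: mult_ac)
  thus ?thesis using h_pos[OF k0(1)] by simp
qed

text \<open>The truncated subtraction is exact on X by \<open>ret_step\<close>: a step is the
  position in the tower of level n + 1 at which the current block starts.\<close>

definition step :: "nat \<Rightarrow> 'a \<Rightarrow> nat" where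
  "step n x = ret (Suc n) x - ret n x"

lemma step_eq: "x \<in> X \<Longrightarrow> ret (Suc n) x = step n x + ret n x"
  and step_vis: "x \<in> X \<Longrightarrow> step n x \<in> vis n (tow (Suc n) x) (tow n x)"
  using ret_step[of x n] unfolding step_def by auto

lemma dnint_step: "x \<in> X \<Longrightarrow> dnint (\<alpha> * real (step n x)) \<le> L * V n"
  using dnint_vis[OF address(1) address(1) step_vis] by blast

text \<open>Off the roof of level n the time to the roof drops by one under T, so this function
  satisfies the eigenvalue equation exactly there.\<close>

definition approx :: "nat \<Rightarrow> 'a \<Rightarrow> complex" where
  "approx n x = unit_char (- (\<alpha> * real (ret n x)))"

lemma approx_step:
  "x \<in> X \<Longrightarrow> approx (Suc n) x = approx n x * unit_char (- (\<alpha> * real (step n x)))"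
  unfolding approx_def by (simp add: step_eq algebra_simps flip: unit_char_add)

lemma norm_approx_diff:
  assumes "x \<in> X" shows "norm (approx (Suc n) x - approx n x) \<le> 2 * pi * L * V n"
proof -
  have "norm (approx (Suc n) x - approx n x)
      = norm (approx n x * (unit_char (- (\<alpha> * real (step n x))) - 1))"
    using approx_step[OF assms] by (simp add: ring_distribs)
  also have "\<dots> = norm (unit_char (- (\<alpha> * real (step n x))) - 1)"
    by (simp add: norm_mult approx_def)
  also have "\<dots> \<le> 2 * pi * dnint (- (\<alpha> * real (step n x)))"
    by (rule norm_unit_char_minus_one_le)
  also have "\<dots> \<le> 2 * pi * (L * V n)"
    unfolding dnint_uminus by (intro mult_left_mono dnint_step assms) auto
  finally show ?thesis by simp
qed

lemma eventually_approx_T: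
  assumes "x \<in> X" "x \<noteq> x0"
  shows "\<forall>\<^sub>F n in sequentially. approx n (T x) = unit_char \<alpha> * approx n x"
  using eventually_ret_T[OF assms]
proof eventually_elim
  case (elim n)
  have "- (\<alpha> * real (ret n (T x))) = \<alpha> + - (\<alpha> * real (ret n x))"
    unfolding elim by (simp add: algebra_simps)
  thus ?case unfolding approx_def by (simp only: unit_char_add)
qed

text \<open>The M-test applies to the telescoping differences, each bounded by a constant times
  \<open>V n\<close>; every \<open>approx n\<close> is continuous because \<open>ret n\<close> is
  locally constant.\<close>

lemma uniform_limit_approx:
  assumes "summable V"
  obtains f where "continuous_on X f" "\<And>x. x \<in> X \<Longrightarrow> (\<lambda>n. approx n x) \<longlonglongrightarrow> f x"
proof -
  let ?d = "\<lambda>n x. approx (Suc n) x - approx n x"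
  have ul: "uniform_limit X (\<lambda>n x. \<Sum>i<n. ?d i x) (\<lambda>x. \<Sum>i. ?d i x) sequentially"
    using norm_approx_diff assms by (intro Weierstrass_m_test[of X ?d "\<lambda>n. 2 * pi * L * V n"]) auto
  have c: "continuous_on X (approx n)" for n
    unfolding approx_def by (rule continuous_on_ret)
  have "continuous_on X (\<lambda>x. \<Sum>i. ?d i x)"
    by (rule uniform_limit_theorem[OF _ ul]) (auto intro!: always_eventually continuous_intros c)
  hence "continuous_on X (\<lambda>x. approx 0 x + (\<Sum>i. ?d i x))" by (intro continuous_intros c)
  moreover have "(\<lambda>n. approx n x) \<longlonglongrightarrow> approx 0 x + (\<Sum>i. ?d i x)" if "x \<in> X" for x
  proof -
    have "(\<lambda>n. approx 0 x + (\<Sum>i<n. ?d i x)) \<longlonglongrightarrow> approx 0 x + (\<Sum>i. ?d i x)"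
      using tendsto_uniform_limitI[OF ul that] by (intro tendsto_intros)
    thus ?thesis by (subst (asm) sum_lessThan_telescope) simp
  qed
  ultimately show ?thesis using that by blast
qed

end

section \<open>Invariant measure and continuous eigenvalues\<close>

text \<open>A bootstrap: a partial sum at most 1/8 becomes at most 1/4 after one more term. Below
  1/2 the distance to the integers is the sum itself, so it is again at most 1/8.\<close>

lemma summable_of_dnint_partial_sums:
  fixes u :: "nat \<Rightarrow> real"
  assumes nonneg: "\<And>n. 0 \<le> u n" and small: "\<And>n. a \<le> n \<Longrightarrow> u n \<le> 1 / 8"
    and sums: "\<And>b. dnint (\<Sum>n=a..<b. u n) \<le> 1 / 8"
  shows "summable u"
proof -
  have bound: "(\<Sum>n=a..<a + m. u n) \<le> 1 / 8" for m
  proof (induction m)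
    case (Suc m)
    let ?s = "\<Sum>n=a..<a + Suc m. u n"
    have "?s \<le> 1 / 4" using Suc small[of "a + m"] by simp
    moreover have "0 \<le> ?s" by (intro sum_nonneg nonneg)
    ultimately have "round ?s = 0" by (intro round_unique') auto
    hence "dnint ?s = ?s" using \<open>0 \<le> ?s\<close> by (simp add: dnint_def)
    thus ?case using sums[of "a + Suc m"] by simp
  qed simp
  have "summable (\<lambda>m. u (m + a))"
  proof (rule summableI_nonneg_bounded[of _ "1/8"])
    fix m
    have "(\<Sum>i<m. u (i + a)) = (\<Sum>n=a..<a + m. u n)"
      using sum.shift_bounds_nat_ivl[of u 0 a m] by (simp add: lessThan_atLeast0 add.commute)
    thus "(\<Sum>i<m. u (i + a)) \<le> 1 / 8" using bound by simp
  qed (rule nonneg)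
  thus ?thesis by simp
qed

section \<open>The invariant measure of towers and transfer of integrals along them\<close>

locale kr_measure = kr_char X T Ti C B h L \<alpha>
  for X :: "'a::metric_space set" and T Ti :: "'a \<Rightarrow> 'a"
    and C :: "nat \<Rightarrow> nat" and B :: "nat \<Rightarrow> nat \<Rightarrow> 'a set" and h :: "nat \<Rightarrow> nat \<Rightarrow> nat"
    and L \<alpha> :: real +
  fixes \<mu> :: "'a measure"
  assumes inv: "invariant_prob X T \<mu>"
begin

sublocale prob_space \<mu>
  using inv by (simp add: invariant_prob_def)

lemma sets_mu: "sets \<mu> = sets (restrict_space borel X)"
  using inv by (simp add: invariant_prob_def)

lemma space_mu [simp]: "space \<mu> = X"
  using sets_eq_imp_space_eq[OF sets_mu] by (simp add: space_restrict_space)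

lemma T_measurable [measurable]: "T \<in> measurable \<mu> \<mu>"
  using inv by (simp add: invariant_prob_def)

lemma openin_sets:
  assumes "openin (top_of_set X) U" shows "U \<in> sets \<mu>"
proof -
  obtain S where S: "open S" "U = X \<inter> S" using assms unfolding openin_open by blast
  have "X \<inter> S \<in> (\<inter>) X ` sets borel" by (intro imageI borel_open S(1))
  thus ?thesis by (simp only: sets_mu sets_restrict_space S(2))
qed

lemma atom_sets [measurable]: "k \<in> idx n \<Longrightarrow> atom n k j \<in> sets \<mu>"
  by (intro openin_sets openin_atom)

lemma B_sets [measurable]: "k \<in> idx n \<Longrightarrow> B n k \<in> sets \<mu>"
  by (intro openin_sets B_open)

lemma continuous_measurable:
  fixes f :: "'a \<Rightarrow> 'b::topological_space"
  assumes "continuous_on X f" shows "f \<in> borel_measurable \<mu>"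
  using borel_measurable_continuous_on_restrict[OF assms] measurable_cong_sets[OF sets_mu refl]
  by blast

lemma ret_measurable [measurable]: "ret n \<in> measurable \<mu> (count_space UNIV)"
proof (rule measurableI)
  fix A :: "nat set"
  have "openin (top_of_set X) (X \<inter> ret n -` A)"
    using continuous_on_ret[of "\<lambda>j. j" n] Topological_Spaces.open_discrete[of A]
    by (intro continuous_openin_preimage_gen) simp_all
  from openin_sets[OF this] show "ret n -` A \<inter> space \<mu> \<in> sets \<mu>" by (simp add: Int_commute)
qed auto

lemma preim_eq: "preim X T j A = (T ^^ j) -` A \<inter> space \<mu>"
  by (auto simp: preim_def)

lemma preim_sets [measurable]: "A \<in> sets \<mu> \<Longrightarrow> preim X T j A \<in> sets \<mu>"
  unfolding preim_eq by measurable

lemma emeasure_preim: "A \<in> sets \<mu> \<Longrightarrow> emeasure \<mu> (preim X T j A) = emeasure \<mu> A"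
proof (induction j)
  case 0
  hence "preim X T 0 A = A" using sets.sets_into_space by (fastforce simp: preim_def)
  thus ?case by simp
next
  case (Suc j)
  have "preim X T (Suc j) A = T -` preim X T j A \<inter> space \<mu>"
    by (auto simp: preim_def funpow_swap1 T_in simp del: funpow.simps(2) intro: funpow_Suc_right)
      (simp_all add: funpow_Suc_right del: funpow.simps(2))
  thus ?case using Suc inv preim_sets[OF Suc.prems, of j] by (simp add: invariant_prob_def)
qed

lemma measure_preim: "A \<in> sets \<mu> \<Longrightarrow> measure \<mu> (preim X T j A) = measure \<mu> A"
  by (simp add: measure_def emeasure_preim)

lemma distr_Tn: "distr \<mu> \<mu> (T ^^ j) = \<mu>"
proof (rule measure_eqI)
  fix A assume "A \<in> sets (distr \<mu> \<mu> (T ^^ j))"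
  thus "emeasure (distr \<mu> \<mu> (T ^^ j)) A = emeasure \<mu> A"
    using emeasure_preim[of A j] by (simp add: emeasure_distr preim_eq)
qed simp

lemma set_integral_compose_Tn:
  fixes g :: "'a \<Rightarrow> 'b::{banach, second_countable_topology}"
  assumes [measurable]: "g \<in> borel_measurable \<mu>" "A \<in> sets \<mu>"
  shows "(LINT x:preim X T j A|\<mu>. g ((T ^^ j) x)) = (LINT x:A|\<mu>. g x)"
proof -
  have "(LINT x:A|\<mu>. g x) = (LINT x|distr \<mu> \<mu> (T ^^ j). indicator A x *\<^sub>R g x)"
    by (simp add: distr_Tn set_lebesgue_integral_def)
  also have "\<dots> = (LINT x|\<mu>. indicator A ((T ^^ j) x) *\<^sub>R g ((T ^^ j) x))"
    by (rule integral_distr) measurable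
  also have "\<dots> = (LINT x:preim X T j A|\<mu>. g ((T ^^ j) x))"
    unfolding set_lebesgue_integral_def
    by (intro Bochner_Integration.integral_cong) (auto simp: indicator_def preim_def)
  finally show ?thesis by simp
qed

text \<open>Invariance moves the integral along the tower, and the relation pulls out the constant.
  It serves for an eigenfunction f with c a phase, and for the squared modulus of f with c =
  1.\<close>

lemma set_integral_preim:
  fixes g :: "'a \<Rightarrow> 'b::{banach, second_countable_topology, real_normed_field}"
  assumes [measurable]: "g \<in> borel_measurable \<mu>" "A \<in> sets \<mu>"
    and eq: "AE x in \<mu>. g ((T ^^ j) x) = c * g x"
  shows "c * (LINT x:preim X T j A|\<mu>. g x) = (LINT x:A|\<mu>. g x)"
proof -
  have "(LINT x:A|\<mu>. g x) = (LINT x|\<mu>. indicator (preim X T j A) x *\<^sub>R g ((T ^^ j) x))"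
    using set_integral_compose_Tn[OF assms(1,2), of j] by (simp add: set_lebesgue_integral_def)
  also have "\<dots> = (LINT x|\<mu>. c * (indicator (preim X T j A) x *\<^sub>R g x))"
  proof (rule integral_cong_AE)
    show "AE x in \<mu>. indicator (preim X T j A) x *\<^sub>R g ((T ^^ j) x)
        = c * (indicator (preim X T j A) x *\<^sub>R g x)"
      using eq by eventually_elim (auto simp: indicator_def)
  qed measurable
  also have "\<dots> = c * (LINT x:preim X T j A|\<mu>. g x)"
    by (simp only: set_lebesgue_integral_def integral_mult_right_zero)
  finally show ?thesis by simp
qed

text \<open>Uniqueness of addresses leaves at most one nonzero summand. The family A covers both
  uses: all floors (\<open>indicator_space\<close>) and the visits to one base
  (\<open>indicator_B\<close>).\<close>

lemma indicator_sum:
  assumes x: "x \<in> X" and A: "\<And>l. l \<in> idx m \<Longrightarrow> A l \<subseteq> {..<h m l}"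
  shows "(\<Sum>l\<in>idx m. \<Sum>i\<in>A l. indicator (atom m l i) x) = (of_bool (ret m x \<in> A (tow m x)) :: real)"
proof -
  have fin: "finite (A l)" if "l \<in> idx m" for l using A[OF that] finite_subset by blast
  have "(\<Sum>l\<in>idx m. \<Sum>i\<in>A l. indicator (atom m l i) x)
      = (\<Sum>l\<in>idx m. if l = tow m x then of_bool (ret m x \<in> A l) else (0::real))"
  proof (intro sum.cong refl)
    fix l assume l: "l \<in> idx m"
    have "(\<Sum>i\<in>A l. indicator (atom m l i) x :: real)
        = (\<Sum>i\<in>A l. if i = ret m x then of_bool (l = tow m x) else 0)"
    proof (intro sum.cong refl)
      fix i assume "i \<in> A l"
      hence i: "i < h m l" using A[OF l] by blast
      show "indicator (atom m l i) x = (if i = ret m x then of_bool (l = tow m x) else (0::real))"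
      proof (cases "x \<in> atom m l i")
        case True
        thus ?thesis using address_eq[OF l i True] by simp
      next
        case False
        hence "\<not> (i = ret m x \<and> l = tow m x)" using address(3)[OF x, of m] by blast
        thus ?thesis using False by auto
      qed
    qed
    thus "(\<Sum>i\<in>A l. indicator (atom m l i) x)
        = (if l = tow m x then of_bool (ret m x \<in> A l) else (0::real))"
      using fin[OF l] by simp
  qed
  thus ?thesis using address(1)[OF x, of m] by simp
qed

lemma indicator_space: "x \<in> X \<Longrightarrow> (\<Sum>k\<in>idx n. \<Sum>j<h n k. indicator (atom n k j) x) = (1::real)"
  using indicator_sum[of x n "\<lambda>k. {..<h n k}"] address(2)[of x n] by simp

lemma indicator_B:
  assumes x: "x \<in> X" and k: "k \<in> idx n"
  shows "(\<Sum>l\<in>idx (Suc n). \<Sum>i\<in>vis n l k. indicator (atom (Suc n) l i) x) = (indicator (B n k) x :: real)"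
proof -
  have "x \<in> B n k \<longleftrightarrow> ret (Suc n) x \<in> vis n (tow (Suc n) x) k"
    using visI[OF address(1,2)[OF x] k address(3)[OF x]]
      visD(2)[of "ret (Suc n) x" n "tow (Suc n) x" k] address(3)[OF x, of "Suc n"] by blast
  moreover have sub: "vis n l k \<subseteq> {..<h (Suc n) l}" for l using visD(1) by blast
  ultimately show ?thesis unfolding indicator_sum[OF x sub] by (simp add: indicator_def)
qed

lemma integral_split_atoms:
  fixes g :: "'a \<Rightarrow> 'b::{banach, second_countable_topology}"
  assumes g: "integrable \<mu> g"
  shows "(LINT x|\<mu>. g x) = (\<Sum>k\<in>idx n. \<Sum>j<h n k. LINT x:atom n k j|\<mu>. g x)"
proof -
  have "(LINT x|\<mu>. g x) = (LINT x|\<mu>. (\<Sum>k\<in>idx n. \<Sum>j<h n k. indicator (atom n k j) x *\<^sub>R g x))"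
    by (intro Bochner_Integration.integral_cong refl)
      (simp add: indicator_space flip: scaleR_sum_left)
  also have "\<dots> = (\<Sum>k\<in>idx n. \<Sum>j<h n k. LINT x:atom n k j|\<mu>. g x)"
    unfolding set_lebesgue_integral_def
    by (subst Bochner_Integration.integral_sum; (intro sum.cong refl Bochner_Integration.integral_sum
      Bochner_Integration.integrable_sum)?) (auto intro!: integrable_mult_indicator g)
  finally show ?thesis .
qed

lemma set_integral_B_split:
  fixes g :: "'a \<Rightarrow> 'b::{banach, second_countable_topology}"
  assumes g: "integrable \<mu> g" and k: "k \<in> idx n"
  shows "(LINT x:B n k|\<mu>. g x) = (\<Sum>l\<in>idx (Suc n). \<Sum>i\<in>vis n l k. LINT x:atom (Suc n) l i|\<mu>. g x)"
proof -
  have "(LINT x:B n k|\<mu>. g x)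
      = (LINT x|\<mu>. (\<Sum>l\<in>idx (Suc n). \<Sum>i\<in>vis n l k. indicator (atom (Suc n) l i) x *\<^sub>R g x))"
    unfolding set_lebesgue_integral_def by (intro Bochner_Integration.integral_cong refl)
      (simp add: indicator_B[OF _ k] flip: scaleR_sum_left)
  also have "\<dots> = (\<Sum>l\<in>idx (Suc n). \<Sum>i\<in>vis n l k. LINT x:atom (Suc n) l i|\<mu>. g x)"
    unfolding set_lebesgue_integral_def
    by (subst Bochner_Integration.integral_sum; (intro sum.cong refl Bochner_Integration.integral_sum
      Bochner_Integration.integrable_sum)?) (auto intro!: integrable_mult_indicator g)
  finally show ?thesis .
qed

abbreviation "b n k \<equiv> measure \<mu> (B n k)"

lemma set_integral_one: "A \<in> sets \<mu> \<Longrightarrow> (LINT x:A|\<mu>. 1) = measure \<mu> A"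
  using sets.sets_into_space[of A \<mu>] by (simp add: set_lebesgue_integral_def Int_absorb2)

lemma weights_sum: "(\<Sum>k\<in>idx n. real (h n k) * b n k) = 1"
proof -
  have "1 = (LINT x|\<mu>. (1::real))" using prob_space by simp
  also have "\<dots> = (\<Sum>k\<in>idx n. \<Sum>j<h n k. LINT x:atom n k j|\<mu>. 1)"
    by (rule integral_split_atoms) simp
  also have "\<dots> = (\<Sum>k\<in>idx n. real (h n k) * b n k)"
    by (intro sum.cong refl) (simp add: set_integral_one measure_preim)
  finally show ?thesis by simp
qed

lemma b_rec: "k \<in> idx n \<Longrightarrow> b n k = (\<Sum>l\<in>idx (Suc n). real (card (vis n l k)) * b (Suc n) l)"
  using set_integral_B_split[of "\<lambda>_. 1::real" k n]
  by (simp add: set_integral_one measure_preim)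

text \<open>By linear recurrence each tower of level n + 1 has height at most L
  \<open>h n k\<close>, and it contains at least one block of type k. Hence every tower of level n
  carries at least the fraction 1/L of the total mass.\<close>

lemma weight_ge:
  assumes k: "k \<in> idx n" shows "1 / L \<le> real (h n k) * b n k"
proof -
  have "1 / L = (\<Sum>l\<in>idx (Suc n). real (h (Suc n) l) / L * b (Suc n) l)"
    using weights_sum[of "Suc n"] by (simp flip: sum_divide_distrib)
  also have "\<dots> \<le> (\<Sum>l\<in>idx (Suc n). real (card (vis n l k)) * real (h n k) * b (Suc n) l)"
  proof (intro sum_mono mult_right_mono measure_nonneg)
    fix l assume l: "l \<in> idx (Suc n)"
    have "real (h (Suc n) l) / L \<le> 1 * real (h n k)"
      using LR[OF l k] L_ge by (simp add: field_simps)
    also have "\<dots> \<le> real (card (vis n l k)) * real (h n k)"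
      by (intro mult_right_mono card_vis_ge k l) simp
    finally show "real (h (Suc n) l) / L \<le> real (card (vis n l k)) * real (h n k)" .
  qed
  also have "\<dots> = real (h n k) * b n k"
    unfolding b_rec[OF k] sum_distrib_left by (intro sum.cong) (auto simp: mult_ac)
  finally show ?thesis .
qed

lemma b_pos: "k \<in> idx n \<Longrightarrow> 0 < b n k"
  using weight_ge[of k n] L_ge h_pos[of k n]
  by (metis divide_pos_pos less_le_trans mult_zero_right order_less_irrefl zero_less_measure_iff
      zero_less_numeral zero_less_one)

text \<open>Aperiodicity makes the preimages of \<open>x0\<close> under different powers of T
  disjoint; they have equal measure, so a positive one would exceed total mass 1.\<close>

lemma AE_neq_x0: "AE x in \<mu>. x \<noteq> x0"
proof -
  have x0s: "{x0} \<in> sets \<mu>"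
    using x0_in by (auto simp: sets_mu sets_restrict_space intro!: image_eqI[of _ _ "{x0}"])
  have "measure \<mu> {x0} = 0"
  proof (rule ccontr)
    assume "measure \<mu> {x0} \<noteq> 0"
    hence c: "0 < measure \<mu> {x0}" by (simp add: zero_less_measure_iff)
    obtain N :: nat where N: "1 < real N * measure \<mu> {x0}" using c reals_Archimedean3 by blast
    have "disjoint_family_on (\<lambda>j. preim X T j {x0}) {..<N}"
    proof -
      have "i = j" if "x \<in> preim X T i {x0}" "x \<in> preim X T j {x0}" "i \<le> j" for i j x
      proof (rule ccontr)
        assume "i \<noteq> j"
        have "(T ^^ ((j - i) + i)) x = (T ^^ (j - i)) x0"
          using that by (subst funpow_add) (simp add: preim_def)
        hence "(T ^^ (j - i)) x0 = x0" using that by (simp add: preim_def)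
        thus False using x0_aperiodic[of "j - i"] that(3) \<open>i \<noteq> j\<close> by simp
      qed
      thus ?thesis unfolding disjoint_family_on_def by (metis disjoint_iff nat_le_linear)
    qed
    hence "measure \<mu> (\<Union>j<N. preim X T j {x0}) = (\<Sum>j<N. measure \<mu> (preim X T j {x0}))"
      using x0s by (intro finite_measure_finite_Union) auto
    also have "\<dots> = real N * measure \<mu> {x0}" using x0s by (simp add: measure_preim)
    finally show False using N prob_le_1[of "\<Union>j<N. preim X T j {x0}"] by simp
  qed
  hence "{x0} \<in> null_sets \<mu>" using x0s by (simp add: null_sets_def emeasure_eq_measure)
  from AE_not_in[OF this] show ?thesis by simp
qed

lemma approx_measurable [measurable]: "approx n \<in> borel_measurable \<mu>"
  unfolding approx_def by measurable

text \<open>\<open>eventually_approx_T\<close> carries convergence at x over to T x, and the last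
  hypothesis identifies f (T x) with the limit found there. The factors \<open>\<kappa> n\<close>
  make room for a normalisation.\<close>

lemma AE_eigen_limit:
  fixes \<kappa> :: "nat \<Rightarrow> complex"
  assumes "AE x in \<mu>. (\<lambda>n. \<kappa> n * approx (r n) x) \<longlonglongrightarrow> f x" and r: "strict_mono r"
    and "\<And>x y. x \<in> X \<Longrightarrow> (\<lambda>n. \<kappa> n * approx (r n) x) \<longlonglongrightarrow> y \<Longrightarrow> f x = y"
  shows "AE x in \<mu>. f (T x) = unit_char \<alpha> * f x"
  using assms(1) AE_neq_x0 AE_space
proof eventually_elim
  case (elim x)
  have "\<forall>\<^sub>F n in sequentially. approx (r n) (T x) = unit_char \<alpha> * approx (r n) x"
    using eventually_approx_T[of x] elim eventually_subseq[OF r] by simp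
  hence "\<forall>\<^sub>F n in sequentially. \<kappa> n * approx (r n) (T x) = unit_char \<alpha> * (\<kappa> n * approx (r n) x)"
    by eventually_elim simp
  moreover have "(\<lambda>n. unit_char \<alpha> * (\<kappa> n * approx (r n) x)) \<longlonglongrightarrow> unit_char \<alpha> * f x"
    using elim(1) by (intro tendsto_intros)
  ultimately have "(\<lambda>n. \<kappa> n * approx (r n) (T x)) \<longlonglongrightarrow> unit_char \<alpha> * f x"
    by (rule tendsto_cong[THEN iffD2])
  hence "f (T x) = unit_char \<alpha> * f x" using elim(3) by (intro assms(3)) (simp add: T_in)
  thus ?case .
qed

lemma norm_one_eigenfunction:
  assumes [measurable]: "f \<in> borel_measurable \<mu>" and n: "AE x in \<mu>. norm (f x :: complex) = 1"
  shows "integrable \<mu> (\<lambda>x. (norm (f x))\<^sup>2)" "\<not> (AE x in \<mu>. f x = 0)"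
proof -
  have "AE x in \<mu>. norm ((norm (f x))\<^sup>2) \<le> 1" using n by eventually_elim simp
  thus "integrable \<mu> (\<lambda>x. (norm (f x))\<^sup>2)" by (intro integrable_const_bound) auto
  show "\<not> (AE x in \<mu>. f x = 0)"
  proof
    assume "AE x in \<mu>. f x = 0"
    with n have "AE x in \<mu>. False" by eventually_elim simp
    thus False by simp
  qed
qed

lemma summable_imp_continuous_eigenvalue:
  assumes "summable V" shows "continuous_eigenvalue X \<mu> T (unit_char \<alpha>)"
proof -
  obtain f where f: "continuous_on X f" "\<And>x. x \<in> X \<Longrightarrow> (\<lambda>n. approx n x) \<longlonglongrightarrow> f x"
    using uniform_limit_approx[OF assms] by blast
  have n: "norm (f x) = 1" if "x \<in> X" for x
    using tendsto_norm[OF f(2)[OF that]] by (simp add: approx_def LIMSEQ_const_iff)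
  have m: "f \<in> borel_measurable \<mu>" by (rule continuous_measurable[OF f(1)])
  have "AE x in \<mu>. f (T x) = unit_char \<alpha> * f x"
    using f(2) LIMSEQ_unique by (intro AE_eigen_limit[of "\<lambda>_. 1" id]) (auto simp: strict_mono_def)
  moreover have "AE x in \<mu>. norm (f x) = 1" using n by (intro AE_I2) simp
  ultimately show ?thesis
    unfolding continuous_eigenvalue_def using f(1) m norm_one_eigenfunction[OF m] by blast
qed

section \<open>Return times and the necessary condition for continuous eigenvalues\<close>

text \<open>Both the \<open>i\<close>-th and the \<open>(i + h n k)\<close>-th preimage of \<open>roof (n + 2)\<close> lie in \<open>roof n\<close>, where
  \<open>i\<close> is a visit of the first tower of level \<open>n + 1\<close> to \<open>B n k\<close>; as they differ by \<open>h n k\<close>, one of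
  these two times is at least half as far from being a period as \<open>h n k\<close>.\<close>

lemma good_time:
  "\<exists>e. V n / 2 \<le> dnint (\<alpha> * real e) \<and>
       (\<forall>y\<in>X. (T ^^ e) y \<in> roof C B (n + 2) \<longrightarrow> y \<in> roof C B n)"
proof -
  obtain k where k: "k \<in> idx n" "V n = dnint (\<alpha> * real (h n k))" using V_attained by blast
  obtain i where i: "i \<in> vis n 1 k" using vis_nonempty[OF k(1) one_idx] by blast
  have at: "y \<in> atom (Suc n) 1 e" if "y \<in> X" "(T ^^ e) y \<in> roof C B (n + 2)" for y e
    using that roof_Suc_sub_B1[of "Suc n"] by (auto simp: preim_def)
  have 1: "y \<in> roof C B n" if "y \<in> X" "(T ^^ i) y \<in> roof C B (n + 2)" for y
    using at[OF that] visD(2)[OF i] B_sub_roof[OF k(1)] by blast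
  have 2: "y \<in> roof C B n" if "y \<in> X" "(T ^^ (i + h n k)) y \<in> roof C B (n + 2)" for y
    using at[OF that] atom_add_sub[OF i] return_roof[OF k(1)] by blast
  have "\<alpha> * real (h n k) = \<alpha> * real (i + h n k) + - (\<alpha> * real i)" by (simp add: algebra_simps)
  hence "V n \<le> dnint (\<alpha> * real (i + h n k)) + dnint (\<alpha> * real i)"
    using dnint_triangle[of "\<alpha> * real (i + h n k)" "- (\<alpha> * real i)"] k(2) by (simp add: dnint_uminus)
  hence "V n / 2 \<le> dnint (\<alpha> * real i) \<or> V n / 2 \<le> dnint (\<alpha> * real (i + h n k))" by linarith
  thus ?thesis using 1 2 by blast
qed

definition gtime :: "nat \<Rightarrow> nat" where
  "gtime n = (SOME e. V n / 2 \<le> dnint (\<alpha> * real e) \<and>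
       (\<forall>y\<in>X. (T ^^ e) y \<in> roof C B (n + 2) \<longrightarrow> y \<in> roof C B n))"

lemma gtime: "V n / 2 \<le> dnint (\<alpha> * real (gtime n))"
  "y \<in> X \<Longrightarrow> (T ^^ gtime n) y \<in> roof C B (n + 2) \<Longrightarrow> y \<in> roof C B n"
  using someI_ex[OF good_time, of n, folded gtime_def] by blast+

text \<open>Each good time lifts a point from the roof of level n + 2 to that of level n.
  Consecutive indices would need overlapping levels, so S contains none.\<close>

lemma gtime_chain:
  assumes S: "\<And>n. n \<in> S \<Longrightarrow> Suc n \<notin> S" and y: "y \<in> X" and "a \<le> c"
    and "(T ^^ (\<Sum>n=a..<c. if n \<in> S then gtime n else 0)) y \<in> roof C B (Suc c)"
  shows "y \<in> roof C B a"
proof -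
  let ?D = "\<lambda>c. \<Sum>n=a..<c. if n \<in> S then gtime n else 0"
  \<comment> \<open>The induction needs the deeper roof of level c + 1 only when c - 1 is in S,
    because that last good time starts from level (c - 1) + 2.\<close>
  have "y \<in> roof C B a" if "a \<le> c" "(T ^^ ?D c) y \<in> roof C B (if a < c \<and> c - 1 \<in> S then Suc c else c)" for c
    using that
  proof (induction c rule: dec_induct)
    case (step c)
    let ?z = "(T ^^ ?D c) y"
    have e: "(T ^^ ?D (Suc c)) y = (T ^^ (if c \<in> S then gtime c else 0)) ?z"
    proof -
      have "?D (Suc c) = (if c \<in> S then gtime c else 0) + ?D c" using step.hyps by simp
      thus ?thesis by (simp only: funpow_add comp_apply)
    qed
    show ?case
    proof (cases "c \<in> S")
      case True
      have "(T ^^ gtime c) ?z \<in> roof C B (c + 2)" using step.prems e True step.hyps by simp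
      hence z: "?z \<in> roof C B c" by (rule gtime(2)[OF Tn_in[OF y]])
      have "(if a < c \<and> c - 1 \<in> S then Suc c else c) = c" using S[of "c - 1"] True by auto
      thus ?thesis using step.IH[folded One_nat_def] z by (simp only:)
    next
      case False
      hence "?z \<in> roof C B (Suc c)" using step.prems e by simp
      thus ?thesis using step.IH roof_Suc[of c] by auto
    qed
  qed simp
  thus ?thesis using assms(3,4) roof_Suc[of c] by auto
qed

text \<open>With one common sign s the residues add up without cancellation, so their partial sums
  agree, up to sign and modulo integers, with \<alpha> times a return time to the roof of level N.
  The bootstrap then applies.\<close>

lemma summable_gtime_class:
  assumes S: "\<And>n. n \<in> S \<Longrightarrow> Suc n \<notin> S"
    and per: "\<And>x d. x \<in> roof C B N \<Longrightarrow> (T ^^ d) x \<in> roof C B N \<Longrightarrow> dnint (\<alpha> * real d) \<le> 1 / 8"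
    and sgn: "\<And>n. n \<in> S \<Longrightarrow> \<alpha> * real (gtime n) - of_int (round (\<alpha> * real (gtime n))) = s * dnint (\<alpha> * real (gtime n))"
    and s: "s = 1 \<or> s = -1"
  shows "summable (\<lambda>n. if n \<in> S then dnint (\<alpha> * real (gtime n)) else 0)"
proof (rule summable_of_dnint_partial_sums[of _ N])
  let ?u = "\<lambda>n. if n \<in> S then dnint (\<alpha> * real (gtime n)) else 0"
  let ?D = "\<lambda>a c. \<Sum>n=a..<c. if n \<in> S then gtime n else 0"
  have D: "dnint (\<alpha> * real (?D a c)) \<le> 1 / 8" if "N \<le> a" "a \<le> c" for a c
  proof -
    \<comment> \<open>The endpoint is \<open>x0\<close> because it lies in the roof of every level,
      as \<open>gtime_chain\<close> asks.\<close>
    obtain y where y: "y \<in> X" "(T ^^ ?D a c) y = x0" using Tn_surj[OF x0_in] by blast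
    have "y \<in> roof C B a" using y x0_roof by (intro gtime_chain[OF S y(1) that(2)]) auto
    hence "y \<in> roof C B N" using roof_mono[OF that(1)] by blast
    thus ?thesis using per[of y "?D a c"] y x0_roof by simp
  qed
  show "0 \<le> ?u n" for n by (simp add: dnint_nonneg)
  show "?u n \<le> 1 / 8" if "N \<le> n" for n
    using D[of n "Suc n"] that by (auto split: if_splits)
  fix c
  show "dnint (\<Sum>n=N..<c. ?u n) \<le> 1 / 8"
  proof (cases "N \<le> c")
    case True
    let ?z = "\<Sum>n=N..<c. if n \<in> S then round (\<alpha> * real (gtime n)) else 0"
    have "\<alpha> * real (?D N c) - of_int ?z = s * (\<Sum>n=N..<c. ?u n)"
      unfolding of_nat_sum of_int_sum sum_distrib_left sum_subtractf[symmetric]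
      by (intro sum.cong) (auto simp: sgn)
    hence "dnint (s * (\<Sum>n=N..<c. ?u n)) \<le> \<bar>\<alpha> * real (?D N c) - of_int ?z - of_int (round (\<alpha> * real (?D N c)) - ?z)\<bar>"
      using dnint_le[of "s * (\<Sum>n=N..<c. ?u n)" "round (\<alpha> * real (?D N c)) - ?z"] by simp
    also have "\<dots> = dnint (\<alpha> * real (?D N c))" by (simp add: dnint_def)
    also have "\<dots> \<le> 1 / 8" using D[OF order.refl True] .
    finally show ?thesis using s by (auto simp: dnint_uminus)
  qed (simp add: dnint_def)
qed

lemma continuous_eigenvalue_imp_summable:
  assumes "continuous_eigenvalue X \<mu> T (unit_char \<alpha>)" shows "summable V"
proof -
  obtain f where f: "continuous_on X f" "\<not> (AE x in \<mu>. f x = 0)"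
      "AE x in \<mu>. f (T x) = unit_char \<alpha> * f x"
    using assms unfolding continuous_eigenvalue_def by blast
  \<comment> \<open>The almost everywhere equation holds everywhere: by continuity its failure set
    is relatively open, so if nonempty it would contain a cell, which has positive measure.\<close>
  have fT: "f (T x) = unit_char \<alpha> * f x" if x: "x \<in> X" for x
  proof (rule ccontr)
    assume ne: "f (T x) \<noteq> unit_char \<alpha> * f x"
    let ?g = "\<lambda>x. f (T x) - unit_char \<alpha> * f x"
    have "continuous_on X ?g"
      using homeo T_in by (intro continuous_intros f(1) continuous_on_compose2[OF f(1), of X T])
        (auto simp: homeomorphism_def)
    hence "openin (top_of_set X) (X \<inter> ?g -` (- {0}))"
      by (intro continuous_openin_preimage_gen) auto
    then obtain n where n: "cell n x \<subseteq> X \<inter> ?g -` (- {0})"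
      using cell_basis[of _ x] x ne by fastforce
    have "AE x' in \<mu>. x' \<notin> cell n x" using f(3) by eventually_elim (use n in auto)
    hence "cell n x \<in> null_sets \<mu>" using address(1)[OF x] by (subst AE_iff_null_sets) auto
    hence "measure \<mu> (cell n x) = 0" by (simp add: measure_eq_0_null_sets)
    thus False using address(1)[OF x, of n] b_pos[OF address(1)[OF x, of n]] measure_preim by simp
  qed
  have fTn: "f ((T ^^ d) x) = unit_char (\<alpha> * real d) * f x" if "x \<in> X" for x d
    using that by (induction d) (simp_all add: fT Tn_in unit_char_add[symmetric] ring_distribs)
  \<comment> \<open>A zero at \<open>x0\<close> would spread over its two-sided orbit, which is
    dense, so f would vanish on X.\<close>
  have fx0: "f x0 \<noteq> 0"
  proof
    assume 0: "f x0 = 0"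
    have Tin: "(Ti ^^ d) x0 \<in> X \<and> f ((Ti ^^ d) x0) = 0" for d
    proof (induction d)
      case (Suc d)
      thus ?case using fT[of "Ti ((Ti ^^ d) x0)"] by (simp add: Ti_in T_Ti)
    qed (simp add: x0_in 0)
    have "closed X" using minimal compact_imp_closed
      by (auto simp: minimal_cantor_system_def cantor_space_def)
    hence "closed {x \<in> X. f x = 0}" using f(1) by (intro continuous_closed_preimage_constant)
    moreover have "orbit T Ti x0 \<subseteq> {x \<in> X. f x = 0}"
      unfolding orbit_def using fTn[OF x0_in] 0 Tin Tn_in[OF x0_in] by auto
    ultimately have "closure (orbit T Ti x0) \<subseteq> {x \<in> X. f x = 0}" by (rule closure_minimal[rotated])
    hence "\<forall>x\<in>X. f x = 0" using minimal x0_in unfolding minimal_cantor_system_def by blast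
    hence "AE x in \<mu>. f x = 0" by (intro AE_I2) simp
    thus False using f(2) by simp
  qed
  \<comment> \<open>With c the modulus of f at \<open>x0\<close>, radius c/32 keeps two values on
    the roof within c/16 of each other while their moduli are at least c/2. The phase error is then
    at most 1/8, the threshold of the bootstrap.\<close>
  have "openin (top_of_set X) (X \<inter> f -` ball (f x0) (norm (f x0) / 32))"
    by (intro continuous_openin_preimage_gen f(1)) auto
  then obtain N where N: "roof C B N \<subseteq> X \<inter> f -` ball (f x0) (norm (f x0) / 32)"
    using roof_shrinks x0_in fx0 by fastforce
  have per: "dnint (\<alpha> * real d) \<le> 1 / 8" if "x \<in> roof C B N" "(T ^^ d) x \<in> roof C B N" for x d
  proof -
    let ?c = "norm (f x0)"
    have d: "dist (f x0) (f x) < ?c / 32" "dist (f x0) (f ((T ^^ d) x)) < ?c / 32"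
      using N that by auto
    have "(unit_char (\<alpha> * real d) - 1) * f x = f ((T ^^ d) x) - f x"
      using fTn[of x d] that(1) roof_sub[of N] by (auto simp: ring_distribs)
    hence "norm (unit_char (\<alpha> * real d) - 1) * norm (f x) = norm (f ((T ^^ d) x) - f x)"
      by (metis norm_mult)
    also have "\<dots> \<le> ?c / 16"
      using d dist_triangle3[of "f ((T ^^ d) x)" "f x" "f x0"] by (simp add: dist_norm)
    finally have 1: "norm (unit_char (\<alpha> * real d) - 1) * norm (f x) \<le> ?c / 16" .
    have "?c / 2 \<le> norm (f x)"
      using d(1)[unfolded dist_norm] norm_triangle_ineq2[of "f x0" "f x"] norm_ge_zero[of "f x0"]
      by linarith
    hence "norm (unit_char (\<alpha> * real d) - 1) * (?c / 2) \<le> norm (unit_char (\<alpha> * real d) - 1) * norm (f x)"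
      by (intro mult_left_mono) auto
    with 1 have "norm (unit_char (\<alpha> * real d) - 1) * ?c \<le> 1 / 8 * ?c" by simp
    hence "norm (unit_char (\<alpha> * real d) - 1) \<le> 1 / 8" using fx0 by (subst (asm) mult_le_cancel_right) auto
    thus ?thesis using dnint_le_norm_unit_char order_trans by blast
  qed
  let ?r = "\<lambda>n. \<alpha> * real (gtime n) - of_int (round (\<alpha> * real (gtime n)))"
  let ?w = "\<lambda>S n. if n \<in> S then dnint (\<alpha> * real (gtime n)) else 0"
  have pos: "summable (?w {n. P n \<and> 0 \<le> ?r n})" if "\<And>n. P n \<Longrightarrow> \<not> P (Suc n)" for P
    using per that by (intro summable_gtime_class[of _ N 1]) (auto simp: dnint_def)
  have neg: "summable (?w {n. P n \<and> ?r n < 0})" if "\<And>n. P n \<Longrightarrow> \<not> P (Suc n)" for P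
    using per that by (intro summable_gtime_class[of _ N "-1"]) (auto simp: dnint_def)
  \<comment> \<open>Fixing the parity excludes consecutive indices, and fixing the sign excludes
    cancellation. Each n lies in exactly one of the four classes; the factor 2 compensates for the
    half lost in \<open>gtime\<close>.\<close>
  have "summable (\<lambda>n. 2 * (?w {n. even n \<and> 0 \<le> ?r n} n + ?w {n. even n \<and> ?r n < 0} n
      + (?w {n. odd n \<and> 0 \<le> ?r n} n + ?w {n. odd n \<and> ?r n < 0} n)))"
    by (intro summable_mult summable_add pos neg) auto
  thus ?thesis
  proof (rule summable_comparison_test')
    fix n
    show "norm (V n) \<le> 2 * (?w {n. even n \<and> 0 \<le> ?r n} n + ?w {n. even n \<and> ?r n < 0} n
      + (?w {n. odd n \<and> 0 \<le> ?r n} n + ?w {n. odd n \<and> ?r n < 0} n))"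
      using gtime(1)[of n] V_nonneg[of n] dnint_nonneg[of "\<alpha> * real (gtime n)"] by auto
  qed
qed

end

section \<open>Measurable eigenvalues: necessity\<close>

lemma cmod_diff_square:
  "(cmod (z - w))\<^sup>2 = (cmod z)\<^sup>2 - 2 * Re (z * cnj w) + (cmod w)\<^sup>2"
  unfolding cmod_power2 by (simp add: power2_eq_square algebra_simps)

lemma Re_of_real_mult: "Re (of_real r * z) = r * Re z"
  by simp

lemma Re_mult_cnj: "Re (w * cnj w) = (cmod w)\<^sup>2"
  unfolding cmod_power2 by (simp add: power2_eq_square)

text \<open>The hypothesis says that w is the weighted mean of z; expanding the square then turns
  the cross term into -2 times the last term.\<close>

lemma variance_identity:
  fixes p :: "'i \<Rightarrow> real" and z :: "'i \<Rightarrow> complex"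
  assumes "(\<Sum>t\<in>I. of_real (p t) * z t) = of_real (\<Sum>t\<in>I. p t) * w"
  shows "(\<Sum>t\<in>I. p t * (cmod (z t - w))\<^sup>2)
       = (\<Sum>t\<in>I. p t * (cmod (z t))\<^sup>2) - (\<Sum>t\<in>I. p t) * (cmod w)\<^sup>2"
proof -
  have "(\<Sum>t\<in>I. p t * Re (z t * cnj w)) = Re ((\<Sum>t\<in>I. of_real (p t) * z t) * cnj w)"
    by (simp add: sum_distrib_right mult.assoc)
  also have "\<dots> = (\<Sum>t\<in>I. p t) * Re (w * cnj w)" unfolding assms by (simp only: mult.assoc Re_of_real_mult)
  also have "Re (w * cnj w) = (cmod w)\<^sup>2" by (rule Re_mult_cnj)
  finally have *: "(\<Sum>t\<in>I. p t * Re (z t * cnj w)) = (\<Sum>t\<in>I. p t) * (cmod w)\<^sup>2" .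
  have "(\<Sum>t\<in>I. p t * (cmod (z t - w))\<^sup>2)
      = (\<Sum>t\<in>I. p t * (cmod (z t))\<^sup>2 - 2 * (p t * Re (z t * cnj w)) + p t * (cmod w)\<^sup>2)"
    unfolding cmod_diff_square by (intro sum.cong refl) (simp only: ring_distribs mult.left_commute[of _ 2])
  also have "\<dots> = (\<Sum>t\<in>I. p t * (cmod (z t))\<^sup>2) - 2 * (\<Sum>t\<in>I. p t * Re (z t * cnj w))
      + (\<Sum>t\<in>I. p t) * (cmod w)\<^sup>2"
    by (simp only: sum.distrib sum_subtractf sum_distrib_left[symmetric] sum_distrib_right[symmetric])
  finally show ?thesis unfolding * by simp
qed

context kr_measure
begin

section \<open>Atoms as a generating pi-system\<close>

definition cyl :: "'a set set" where
  "cyl = insert {} {atom n k j | n k j. k \<in> idx n \<and> j < h n k}"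

lemma cyl_sets: "A \<in> cyl \<Longrightarrow> A \<in> sets \<mu>"
  by (auto simp: cyl_def)

lemma cyl_sub: "cyl \<subseteq> Pow X"
  using atom_sub by (auto simp: cyl_def)

lemma countable_cyl: "countable cyl"
proof -
  have "cyl \<subseteq> insert {} ((\<lambda>(n, k, j). atom n k j) ` UNIV)" unfolding cyl_def by auto
  thus ?thesis by (rule countable_subset) auto
qed

text \<open>Two atoms with a common point x are both cells of x, hence nested; disjoint ones meet in
  the empty set, which \<open>cyl\<close> contains for this reason.\<close>

lemma Int_stable_cyl: "Int_stable cyl"
proof (rule Int_stableI)
  fix A A' assume A: "A \<in> cyl" "A' \<in> cyl"
  show "A \<inter> A' \<in> cyl"
  proof (cases "A \<inter> A' = {}")
    case False
    then obtain x where x: "x \<in> A" "x \<in> A'" by blast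
    obtain n k j where 1: "A = atom n k j" "k \<in> idx n" "j < h n k" using A(1) x by (auto simp: cyl_def)
    obtain m k' j' where 2: "A' = atom m k' j'" "k' \<in> idx m" "j' < h m k'" using A(2) x by (auto simp: cyl_def)
    have xX: "x \<in> X" using x(1) 1(1) by (simp add: preim_def)
    have "A = cell n x" "A' = cell m x"
      using address_eq[OF 1(2,3)] address_eq[OF 2(2,3)] x 1(1) 2(1) by auto
    hence "A \<subseteq> A' \<or> A' \<subseteq> A" using cell_antimono[OF xX] nat_le_linear[of n m] by blast
    hence "A \<inter> A' = A \<or> A \<inter> A' = A'" by blast
    thus ?thesis using A by auto
  qed (simp add: cyl_def)
qed

text \<open>A relatively open set is the union of the atoms inside it, and there are only countably
  many atoms; Borel sets follow by induction over the generated sigma-algebra.\<close>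

lemma sets_sub_sigma_cyl: assumes "A \<in> sets \<mu>" shows "A \<in> sigma_sets X cyl"
proof -
  have op: "U \<in> sigma_sets X cyl" if U: "openin (top_of_set X) U" for U
  proof -
    have "U = \<Union>{A \<in> cyl. A \<subseteq> U}"
    proof (intro equalityI subsetI)
      fix x assume x: "x \<in> U"
      hence xX: "x \<in> X" using openin_imp_subset[OF U] by blast
      obtain n where "cell n x \<subseteq> U" using cell_basis[OF U x] by blast
      moreover have "cell n x \<in> cyl" unfolding cyl_def using address(1,2)[OF xX] by blast
      ultimately show "x \<in> \<Union>{A \<in> cyl. A \<subseteq> U}" using address(3)[OF xX, of n] by blast
    qed blast
    moreover have "countable {A \<in> cyl. A \<subseteq> U}"
      by (rule countable_subset[OF _ countable_cyl]) auto
    hence "\<Union>{A \<in> cyl. A \<subseteq> U} \<in> sigma_sets X cyl"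
      by (intro sigma_sets_UNION) auto
    ultimately show ?thesis by simp
  qed
  have borel: "X \<inter> S \<in> sigma_sets X cyl" if "S \<in> sigma_sets UNIV {S. open S}" for S
    using that
  proof induction
    case (Basic S)
    thus ?case by (intro op) (auto simp: openin_open)
  next
    case Empty
    show ?case by (simp add: sigma_sets.Empty)
  next
    case (Compl S)
    have "X \<inter> (UNIV - S) = X - X \<inter> S" by blast
    thus ?case using sigma_sets.Compl[OF Compl.IH] by simp
  next
    case (Union S)
    have "X \<inter> (\<Union>i. S i) = (\<Union>i. X \<inter> S i)" by blast
    thus ?case using sigma_sets.Union[of "\<lambda>i. X \<inter> S i", OF Union.IH] by simp
  qed
  obtain S where "S \<in> sets borel" "A = X \<inter> S"
    using assms unfolding sets_mu sets_restrict_space by blast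
  thus ?thesis using borel by (simp add: borel_def)
qed

text \<open>The vanishing of the integral passes from the pi-system of atoms to all measurable sets
  by Dynkin's argument.\<close>

lemma AE_zero_if_atom_integrals_zero:
  fixes f :: "'a \<Rightarrow> complex"
  assumes f: "integrable \<mu> f"
    and 0: "\<And>n k j. k \<in> idx n \<Longrightarrow> j < h n k \<Longrightarrow> (LINT x:atom n k j|\<mu>. f x) = 0"
  shows "AE x in \<mu>. f x = 0"
proof (rule density_zero[OF f])
  fix A assume A: "A \<in> sets \<mu>"
  have si: "set_integrable \<mu> A f" if "A \<in> sets \<mu>" for A
    unfolding set_integrable_def using that f by (intro integrable_mult_indicator)
  have sig: "A \<in> sets \<mu>" if "A \<in> sigma_sets X cyl" for A
    using sets.sigma_sets_subset[of cyl \<mu>] cyl_sets that by auto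
  have X0: "(LINT x:X|\<mu>. f x) = 0"
  proof -
    have "(LINT x:X|\<mu>. f x) = (LINT x|\<mu>. f x)"
      unfolding set_lebesgue_integral_def by (intro Bochner_Integration.integral_cong) auto
    thus ?thesis using integral_split_atoms[OF f, of 0] 0 by simp
  qed
  show "(LINT x:A|\<mu>. f x) = 0"
  proof (rule sigma_sets_induct_disjoint[OF Int_stable_cyl cyl_sub sets_sub_sigma_cyl[OF A]])
    fix A assume "A \<in> cyl"
    thus "(LINT x:A|\<mu>. f x) = 0" using 0 by (auto simp: cyl_def set_lebesgue_integral_def)
  next
    show "(LINT x:{}|\<mu>. f x) = 0" by (simp add: set_lebesgue_integral_def)
  next
    fix A assume A: "A \<in> sigma_sets X cyl" "(LINT x:A|\<mu>. f x) = 0"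
    have AX: "A \<subseteq> X" using sets.sets_into_space[OF sig[OF A(1)]] by simp
    have Xs: "X \<in> sets \<mu>" using sets.top[of \<mu>] by simp
    have "(LINT x:A \<union> (X - A)|\<mu>. f x) = (LINT x:A|\<mu>. f x) + (LINT x:X - A|\<mu>. f x)"
      using sig[OF A(1)] Xs by (intro set_integral_Un si) auto
    thus "(LINT x:X - A|\<mu>. f x) = 0" using A(2) X0 AX by (simp add: Un_absorb1)
  next
    fix A :: "nat \<Rightarrow> 'a set"
    assume A: "disjoint_family A" "range A \<subseteq> sigma_sets X cyl" "\<And>i. (LINT x:A i|\<mu>. f x) = 0"
    have s: "A i \<in> sets \<mu>" for i using A(2) sig by blast
    have "(LINT x:(\<Union>i. A i)|\<mu>. f x) = (\<Sum>i. LINT x:A i|\<mu>. f x)"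
      using A(1) s by (intro lebesgue_integral_countable_add si) (auto simp: disjoint_family_on_def)
    thus "(LINT x:(\<Union>i. A i)|\<mu>. f x) = 0" using A(3) by simp
  qed
qed

section \<open>The martingale of conditional expectations of an eigenfunction\<close>

context
  fixes f :: "'a \<Rightarrow> complex"
  assumes fm [measurable]: "f \<in> borel_measurable \<mu>"
    and f2: "integrable \<mu> (\<lambda>x. (cmod (f x))\<^sup>2)"
    and fT: "AE x in \<mu>. f (T x) = unit_char \<alpha> * f x"
begin

lemma f_int: "integrable \<mu> f"
proof (rule Bochner_Integration.integrable_bound[of \<mu> "\<lambda>x. 1 + (cmod (f x))\<^sup>2"])
  have "norm z \<le> 1 + (cmod z)\<^sup>2" for z :: complex
  proof -
    have "0 \<le> (cmod z - 1)\<^sup>2" by simp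
    hence "2 * cmod z \<le> 1 + (cmod z)\<^sup>2" by (simp add: power2_diff)
    thus ?thesis using norm_ge_zero[of z] by linarith
  qed
  thus "AE x in \<mu>. norm (f x) \<le> norm (1 + (cmod (f x))\<^sup>2)" by (simp add: add_nonneg_nonneg)
qed (use f2 in auto)

lemma f_Tn: "AE x in \<mu>. f ((T ^^ j) x) = unit_char (\<alpha> * real j) * f x"
proof (induction j)
  case (Suc j)
  have "AE x in distr \<mu> \<mu> (T ^^ j). f (T x) = unit_char \<alpha> * f x" unfolding distr_Tn by (rule fT)
  hence "AE x in \<mu>. f (T ((T ^^ j) x)) = unit_char \<alpha> * f ((T ^^ j) x)"
    by (rule AE_distrD[rotated]) measurable
  with Suc show ?case
    by eventually_elim (simp add: ring_distribs unit_char_add)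
qed simp

lemma integral_atom:
  assumes "k \<in> idx n"
  shows "(LINT x:atom n k j|\<mu>. f x) = unit_char (- (\<alpha> * real j)) * (LINT x:B n k|\<mu>. f x)"
proof -
  have "unit_char (\<alpha> * real j) * (LINT x:atom n k j|\<mu>. f x) = (LINT x:B n k|\<mu>. f x)"
    using assms by (intro set_integral_preim f_Tn) auto
  thus ?thesis by (simp add: unit_char_uminus field_simps)
qed

text \<open>By \<open>integral_atom\<close>, the conditional expectation of f on floor j of tower k
  is this number times the phase \<open>unit_char (- (\<alpha> * real j))\<close>, so one value per
  tower describes it.\<close>

definition avg :: "nat \<Rightarrow> nat \<Rightarrow> complex" where
  "avg n k = (LINT x:B n k|\<mu>. f x) / of_real (b n k)"

lemma integral_B: "k \<in> idx n \<Longrightarrow> (LINT x:B n k|\<mu>. f x) = of_real (b n k) * avg n k"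
  using b_pos[of k n] by (simp add: avg_def)

text \<open>The squared L2 norm of the conditional expectation of f on the partition of level n; the
  phases on the floors have modulus one.\<close>

definition energy :: "nat \<Rightarrow> real" where
  "energy n = (\<Sum>k\<in>idx n. real (h n k) * (b n k * (cmod (avg n k))\<^sup>2))"

text \<open>The base of tower k splits into the atoms of level n + 1 at its visits. Their averages
  are rotated values \<open>avg (Suc n) l\<close>, with weighted mean \<open>avg n k\<close>, so the
  variance identity applies.\<close>

lemma tower_variance:
  assumes k: "k \<in> idx n"
  shows "(\<Sum>l\<in>idx (Suc n). \<Sum>i\<in>vis n l k. b (Suc n) l * (cmod (unit_char (- (\<alpha> * real i)) * avg (Suc n) l - avg n k))\<^sup>2)
    = (\<Sum>l\<in>idx (Suc n). real (card (vis n l k)) * (b (Suc n) l * (cmod (avg (Suc n) l))\<^sup>2)) - b n k * (cmod (avg n k))\<^sup>2"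
proof -
  let ?I = "SIGMA l:idx (Suc n). vis n l k"
  let ?p = "\<lambda>(l, i). b (Suc n) l" and ?z = "\<lambda>(l, i). unit_char (- (\<alpha> * real i)) * avg (Suc n) l"
  have split: "(\<Sum>l\<in>idx (Suc n). \<Sum>i\<in>vis n l k. F l i) = (\<Sum>(l, i)\<in>?I. F l i)" for F :: "nat \<Rightarrow> nat \<Rightarrow> 'z::comm_monoid_add"
    by (subst sum.Sigma) auto
  have P: "(\<Sum>t\<in>?I. ?p t) = b n k"
    using split[of "\<lambda>l i. b (Suc n) l"] b_rec[OF k] by simp
  have "of_real (b n k) * avg n k = (\<Sum>l\<in>idx (Suc n). \<Sum>i\<in>vis n l k. of_real (b (Suc n) l) * (unit_char (- (\<alpha> * real i)) * avg (Suc n) l))"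
    unfolding integral_B[OF k, symmetric] set_integral_B_split[OF f_int k]
    by (intro sum.cong refl) (simp add: integral_atom integral_B)
  also have "\<dots> = (\<Sum>t\<in>?I. of_real (?p t) * ?z t)"
    unfolding split by (intro sum.cong) auto
  finally have "(\<Sum>t\<in>?I. of_real (?p t) * ?z t) = of_real (\<Sum>t\<in>?I. ?p t) * avg n k" unfolding P ..
  from variance_identity[OF this]
  have "(\<Sum>t\<in>?I. ?p t * (cmod (?z t - avg n k))\<^sup>2) = (\<Sum>t\<in>?I. ?p t * (cmod (?z t))\<^sup>2) - b n k * (cmod (avg n k))\<^sup>2"
    unfolding P .
  moreover have "(\<Sum>t\<in>?I. ?p t * (cmod (?z t - avg n k))\<^sup>2) = (\<Sum>l\<in>idx (Suc n). \<Sum>i\<in>vis n l k. b (Suc n) l * (cmod (unit_char (- (\<alpha> * real i)) * avg (Suc n) l - avg n k))\<^sup>2)"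
    unfolding split by (intro sum.cong) auto
  moreover have "(\<Sum>t\<in>?I. ?p t * (cmod (?z t))\<^sup>2) = (\<Sum>l\<in>idx (Suc n). \<Sum>i\<in>vis n l k. b (Suc n) l * (cmod (avg (Suc n) l))\<^sup>2)"
    unfolding split by (intro sum.cong) (auto simp: norm_mult)
  ultimately show ?thesis by simp
qed

lemma energy_diff:
  "energy (Suc n) - energy n = (\<Sum>k\<in>idx n. real (h n k) * (\<Sum>l\<in>idx (Suc n). \<Sum>i\<in>vis n l k.
     b (Suc n) l * (cmod (unit_char (- (\<alpha> * real i)) * avg (Suc n) l - avg n k))\<^sup>2))"
proof -
  let ?e = "\<lambda>l. b (Suc n) l * (cmod (avg (Suc n) l))\<^sup>2"
  have "energy (Suc n) = (\<Sum>l\<in>idx (Suc n). \<Sum>k\<in>idx n. real (card (vis n l k)) * real (h n k) * ?e l)"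
    unfolding energy_def by (intro sum.cong refl) (simp only: h_rec sum_distrib_right)
  also have "\<dots> = (\<Sum>k\<in>idx n. \<Sum>l\<in>idx (Suc n). real (card (vis n l k)) * real (h n k) * ?e l)"
    by (rule sum.swap)
  also have "\<dots> = (\<Sum>k\<in>idx n. real (h n k) * (\<Sum>l\<in>idx (Suc n). real (card (vis n l k)) * ?e l))"
    by (intro sum.cong refl) (simp add: sum_distrib_left mult_ac)
  finally show ?thesis
    unfolding energy_def[of n] by (simp add: tower_variance right_diff_distrib sum_subtractf cong: sum.cong)
qed

text \<open>The left side occurs in \<open>energy_diff\<close> with weight
  \<open>real (h n k) * b (Suc n) l\<close>. By linear recurrence and \<open>weight_ge\<close> at
  level n + 1, this weight is at least 1 / L^2.\<close>

lemma jump_bound_sq: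
  assumes k: "k \<in> idx n" and l: "l \<in> idx (Suc n)" and i: "i \<in> vis n l k"
  shows "(cmod (unit_char (- (\<alpha> * real i)) * avg (Suc n) l - avg n k))\<^sup>2 \<le> L\<^sup>2 * (energy (Suc n) - energy n)"
proof -
  let ?q = "\<lambda>k l i. b (Suc n) l * (cmod (unit_char (- (\<alpha> * real i)) * avg (Suc n) l - avg n k))\<^sup>2"
  let ?d = "(cmod (unit_char (- (\<alpha> * real i)) * avg (Suc n) l - avg n k))\<^sup>2"
  have q: "0 \<le> ?q k l i" for k l i by simp
  have "?q k l i \<le> (\<Sum>i\<in>vis n l k. ?q k l i)" by (intro member_le_sum i q) auto
  also have "\<dots> \<le> (\<Sum>l\<in>idx (Suc n). \<Sum>i\<in>vis n l k. ?q k l i)"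
    by (rule member_le_sum[OF l]) (auto intro!: sum_nonneg)
  finally have "real (h n k) * ?q k l i \<le> real (h n k) * (\<Sum>l\<in>idx (Suc n). \<Sum>i\<in>vis n l k. ?q k l i)"
    by (rule mult_left_mono) simp
  also have "\<dots> \<le> energy (Suc n) - energy n"
    unfolding energy_diff by (rule member_le_sum[OF k]) (auto intro!: sum_nonneg mult_nonneg_nonneg)
  finally have 1: "real (h n k) * ?q k l i \<le> energy (Suc n) - energy n" .
  have "1 / L * ?d \<le> real (h (Suc n) l) * b (Suc n) l * ?d"
    by (intro mult_right_mono weight_ge l) simp
  also have "\<dots> \<le> L * real (h n k) * b (Suc n) l * ?d"
    by (intro mult_right_mono LR l k) auto
  also have "\<dots> = L * (real (h n k) * ?q k l i)" by simp
  also have "\<dots> \<le> L * (energy (Suc n) - energy n)" using 1 L_ge by (intro mult_left_mono) auto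
  finally have "L * (1 / L * ?d) \<le> L * (L * (energy (Suc n) - energy n))" using L_ge by (intro mult_left_mono) auto
  thus ?thesis using L_ge by (simp add: power2_eq_square mult.assoc)
qed

lemma energy_mono: "energy n \<le> energy (Suc n)"
proof -
  have "0 \<le> L\<^sup>2 * (energy (Suc n) - energy n)"
    using jump_bound_sq[OF one_idx one_idx zero_vis[OF one_idx]] by (rule order_trans[rotated]) simp
  thus ?thesis using L_ge by (simp add: zero_le_mult_iff)
qed

text \<open>On each base the bound comes from integrating the squared modulus of f minus its mean;
  all floors of a tower contribute equally because the modulus of f is invariant under T.\<close>

lemma energy_le: "energy n \<le> (LINT x|\<mu>. (cmod (f x))\<^sup>2)"
proof -
  have le: "b n k * (cmod (avg n k))\<^sup>2 \<le> (LINT x:B n k|\<mu>. (cmod (f x))\<^sup>2)" if k: "k \<in> idx n" for k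
  proof -
    let ?w = "avg n k"
    have i1: "integrable \<mu> (\<lambda>x. indicator (B n k) x *\<^sub>R (cmod (f x))\<^sup>2)"
      using k by (intro integrable_mult_indicator f2) auto
    have i2: "integrable \<mu> (\<lambda>x. indicator (B n k) x *\<^sub>R f x)"
      using k by (intro integrable_mult_indicator f_int) auto
    have i3: "integrable \<mu> (\<lambda>x. (indicator (B n k) x :: real))"
      using k by (intro integrable_real_indicator) (auto simp: emeasure_eq_measure)
    have i2': "integrable \<mu> (\<lambda>x. Re ((indicator (B n k) x *\<^sub>R f x) * cnj ?w))"
      by (intro integrable_Re integrable_mult_left i2)
    have "0 \<le> (LINT x|\<mu>. indicator (B n k) x * (cmod (f x - ?w))\<^sup>2)" by (intro integral_nonneg_AE) auto
    also have "(\<lambda>x. indicator (B n k) x * (cmod (f x - ?w))\<^sup>2)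
        = (\<lambda>x. indicator (B n k) x *\<^sub>R (cmod (f x))\<^sup>2 - 2 * Re ((indicator (B n k) x *\<^sub>R f x) * cnj ?w)
             + (cmod ?w)\<^sup>2 * indicator (B n k) x)"
      by (rule ext) (simp add: cmod_diff_square algebra_simps)
    also have "(LINT x|\<mu>. \<dots> x) = (LINT x:B n k|\<mu>. (cmod (f x))\<^sup>2)
        - 2 * Re ((LINT x:B n k|\<mu>. f x) * cnj ?w) + (cmod ?w)\<^sup>2 * (LINT x|\<mu>. indicator (B n k) x)"
      unfolding set_lebesgue_integral_def using i1 i2 i2' i3
      by (simp del: real_scaleR_def scaleR_complex.simps times_complex.simps mult_scaleR_left)
    also have "Re ((LINT x:B n k|\<mu>. f x) * cnj ?w) = b n k * (cmod ?w)\<^sup>2"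
      unfolding integral_B[OF k] mult.assoc Re_of_real_mult Re_mult_cnj ..
    also have "(LINT x|\<mu>. indicator (B n k) x) = b n k"
      using set_integral_one[OF B_sets[OF k]] by (simp add: set_lebesgue_integral_def)
    finally show ?thesis by (simp add: algebra_simps)
  qed
  have at: "(LINT x:atom n k j|\<mu>. (cmod (f x))\<^sup>2) = (LINT x:B n k|\<mu>. (cmod (f x))\<^sup>2)" if k: "k \<in> idx n" for k j
  proof -
    have "1 * (LINT x:atom n k j|\<mu>. (cmod (f x))\<^sup>2) = (LINT x:B n k|\<mu>. (cmod (f x))\<^sup>2)"
    proof (rule set_integral_preim)
      show "AE x in \<mu>. (cmod (f ((T ^^ j) x)))\<^sup>2 = 1 * (cmod (f x))\<^sup>2"
        using f_Tn[of j] by eventually_elim (simp add: norm_mult)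
    qed (use k in auto)
    thus ?thesis by simp
  qed
  have "energy n \<le> (\<Sum>k\<in>idx n. real (h n k) * (LINT x:B n k|\<mu>. (cmod (f x))\<^sup>2))"
    unfolding energy_def by (intro sum_mono mult_left_mono le) auto
  also have "\<dots> = (LINT x|\<mu>. (cmod (f x))\<^sup>2)"
    unfolding integral_split_atoms[OF f2, of n] by (intro sum.cong refl) (simp add: at)
  finally show ?thesis .
qed

text \<open>A uniform bound for the martingale increments on all atoms of level n + 1. Its square
  telescopes, and the energies are bounded, which gives square summability.\<close>

definition jump :: "nat \<Rightarrow> real" where "jump n = L * sqrt (energy (Suc n) - energy n)"

lemma jump_nonneg: "0 \<le> jump n" using energy_mono[of n] L_ge by (simp add: jump_def)

lemma jump_sq: "(jump n)\<^sup>2 = L\<^sup>2 * (energy (Suc n) - energy n)"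
  using energy_mono[of n] by (simp add: jump_def power_mult_distrib)

lemma summable_jump_sq: "summable (\<lambda>n. (jump n)\<^sup>2)"
proof -
  have "incseq energy" using energy_mono by (rule incseq_SucI)
  then obtain e where "energy \<longlonglongrightarrow> e" using energy_le by (metis incseq_convergent)
  from telescope_summable[OF this] show ?thesis unfolding jump_sq by (rule summable_mult)
qed

lemma jump_bound:
  assumes "k \<in> idx n" "l \<in> idx (Suc n)" "i \<in> vis n l k"
  shows "cmod (unit_char (- (\<alpha> * real i)) * avg (Suc n) l - avg n k) \<le> jump n"
  using jump_bound_sq[OF assms] jump_nonneg unfolding jump_sq[symmetric] by (rule power2_le_imp_le)

text \<open>By (KR6) position 0 of every tower is a visit to the first base, with trivial phase.
  Thus all averages of level n + 1 are close to one another.\<close>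

lemma jump_first: "l \<in> idx (Suc n) \<Longrightarrow> cmod (avg (Suc n) l - avg n 1) \<le> jump n"
  using jump_bound[OF one_idx _ zero_vis, of l n] by simp

lemma energy_pos:
  assumes "\<not> (AE x in \<mu>. f x = 0)" shows "\<exists>n. 0 < energy n"
proof (rule ccontr)
  assume c: "\<not> ?thesis"
  have "avg n k = 0" if k: "k \<in> idx n" for n k
  proof -
    have "real (h n k) * (b n k * (cmod (avg n k))\<^sup>2) \<le> energy n"
      unfolding energy_def by (rule member_le_sum[OF k]) auto
    also have "\<dots> \<le> 0" using c by (simp add: not_less)
    finally have "h n k * b n k * (cmod (avg n k))\<^sup>2 \<le> 0" by (simp add: mult.assoc)
    thus ?thesis using h_pos[OF k] b_pos[OF k] by (auto simp: mult_le_0_iff)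
  qed
  hence "AE x in \<mu>. f x = 0"
    by (intro AE_zero_if_atom_integrals_zero f_int) (simp add: integral_atom integral_B)
  thus False using assms by simp
qed

text \<open>Since the weights sum to 1 and the energy is at least s^2, some average has modulus at
  least s. The others of the same level differ from it by at most two jumps, eventually at most
  s/2.\<close>

lemma avg_lower:
  assumes "\<not> (AE x in \<mu>. f x = 0)"
  shows "\<exists>c>0. \<exists>N. \<forall>n\<ge>N. \<forall>k\<in>idx n. c \<le> cmod (avg n k)"
proof -
  obtain N0 where N0: "0 < energy N0" using energy_pos[OF assms] by blast
  define s where "s = sqrt (energy N0)"
  have s: "0 < s" using N0 by (simp add: s_def)
  have "(\<lambda>n. (jump n)\<^sup>2) \<longlonglongrightarrow> 0" by (rule summable_LIMSEQ_zero[OF summable_jump_sq])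
  hence "\<forall>\<^sub>F n in sequentially. (jump n)\<^sup>2 < (s / 4)\<^sup>2"
    using s by (intro order_tendstoD(2)[of _ 0]) auto
  then obtain N1 where N1: "\<And>n. N1 \<le> n \<Longrightarrow> (jump n)\<^sup>2 < (s / 4)\<^sup>2"
    unfolding eventually_sequentially by blast
  have "s / 2 \<le> cmod (avg n k)" if n: "Suc (max N0 N1) \<le> n" and k: "k \<in> idx n" for n k
  proof -
    obtain m where m: "n = Suc m" "N0 \<le> n" "N1 \<le> m" using n by (cases n) auto
    have "\<exists>k'\<in>idx n. s\<^sup>2 \<le> (cmod (avg n k'))\<^sup>2"
    proof (rule ccontr)
      assume c: "\<not> ?thesis"
      have "energy n < (\<Sum>k\<in>idx n. real (h n k) * (b n k * s\<^sup>2))"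
        unfolding energy_def using c h_pos b_pos by (intro sum_strict_mono mult_strict_left_mono) auto
      also have "\<dots> = s\<^sup>2" using weights_sum[of n] by (simp flip: mult.assoc sum_distrib_right)
      also have "\<dots> = energy N0" using N0 by (simp add: s_def)
      also have "\<dots> \<le> energy n" using lift_Suc_mono_le[of energy, OF energy_mono m(2)] .
      finally show False by simp
    qed
    then obtain k' where k': "k' \<in> idx n" "s\<^sup>2 \<le> (cmod (avg n k'))\<^sup>2" by blast
    have 1: "s \<le> cmod (avg n k')" using k'(2) by (rule power2_le_imp_le) simp
    have 2: "jump m \<le> s / 4" using N1[OF m(3)] s by (intro power2_le_imp_le[of "jump m"]) auto
    have "cmod (avg n k' - avg m 1) \<le> jump m" "cmod (avg n k - avg m 1) \<le> jump m"
      using jump_first k' k m(1) by auto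
    hence "cmod (avg n k' - avg n k) \<le> 2 * jump m"
      using norm_triangle_ineq4[of "avg n k' - avg m 1" "avg n k - avg m 1"] by simp
    thus ?thesis using 1 2 norm_triangle_ineq2[of "avg n k'" "avg n k"] by linarith
  qed
  thus ?thesis using s by (intro exI[of _ "s / 2"] conjI exI[of _ "Suc (max N0 N1)"]) auto
qed

text \<open>With a single tower its base is the whole roof and equals its own preimage under the
  height. The integral of f over it is nonzero and is multiplied by the phase, so the phase is
  1.\<close>

lemma full_return:
  assumes C1: "idx n = {1}" and nz: "avg n 1 \<noteq> 0"
  shows "unit_char (\<alpha> * real (h n 1)) = 1"
proof -
  have "atom n 1 (h n 1) = B n 1"
  proof
    show "atom n 1 (h n 1) \<subseteq> B n 1"
      using return_roof[OF one_idx, of n] C1 by (auto elim!: roofE)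
    show "B n 1 \<subseteq> atom n 1 (h n 1)"
    proof
      fix x assume x: "x \<in> B n 1"
      have xX: "x \<in> X" using x B_sub[OF one_idx] by blast
      have t: "tow n (T x) = 1" using address(1)[OF T_in[OF xX], of n] C1 by simp
      let ?j = "ret n (T x)"
      have at: "x \<in> atom n 1 (Suc ?j)"
        using address(3)[OF T_in[OF xX], of n] preim_add[OF xX, of ?j 1] t by simp
      have "Suc ?j = h n 1"
      proof (rule ccontr)
        assume "Suc ?j \<noteq> h n 1"
        hence "Suc ?j < h n 1" using address(2)[OF T_in[OF xX], of n] t by simp
        from address_eq(2)[OF one_idx this at] roof_ret[of x n] B_sub_roof[OF one_idx, of n] x
        show False by auto
      qed
      thus "x \<in> atom n 1 (h n 1)" using at by simp
    qed
  qed
  moreover have "unit_char (\<alpha> * real (h n 1)) * (LINT x:atom n 1 (h n 1)|\<mu>. f x) = (LINT x:B n 1|\<mu>. f x)"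
    by (intro set_integral_preim f_Tn) auto
  moreover have "(LINT x:B n 1|\<mu>. f x) \<noteq> 0"
    unfolding integral_B[OF one_idx] using nz b_pos[OF one_idx, of n] by simp
  ultimately show ?thesis by simp
qed

lemma return_visit:
  assumes l: "l \<in> idx (Suc n)" and k: "k \<in> idx n" and i: "i \<in> vis n l k" and lt: "i + h n k < h (Suc n) l"
  shows "\<exists>k'\<in>idx n. i + h n k \<in> vis n l k'"
proof -
  obtain x where x: "x \<in> atom (Suc n) l (i + h n k)" using atom_ne[OF l] by blast
  hence "x \<in> roof C B n" using atom_add_sub[OF i] return_roof[OF k] by blast
  then obtain k' where "k' \<in> idx n" "x \<in> B n k'" by (rule roofE)
  thus ?thesis using visI[OF l lt _ x] by blast
qed

lemma rotate_bound: "cmod (unit_char t * z - w) \<le> e \<Longrightarrow> cmod (unit_char (s + t) * z - unit_char s * w) \<le> e"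
proof -
  have "unit_char (s + t) * z - unit_char s * w = unit_char s * (unit_char t * z - w)"
    by (simp add: unit_char_add ring_distribs)
  hence "cmod (unit_char (s + t) * z - unit_char s * w) = cmod (unit_char t * z - w)"
    by (simp add: norm_mult)
  thus "cmod (unit_char t * z - w) \<le> e \<Longrightarrow> cmod (unit_char (s + t) * z - unit_char s * w) \<le> e" by simp
qed

text \<open>If the only visit to \<open>B n k\<close> is the last one in its tower, the next visit to the roof is
  seen two levels up, provided level \<open>n + 1\<close> has at least two towers; with a single tower the
  whole tower height is an exact period.\<close>

lemma period_defect:
  assumes k: "k \<in> idx n" and nz: "avg (Suc n) 1 \<noteq> 0"
  shows "\<exists>k'\<in>idx n. cmod (unit_char (- (\<alpha> * real (h n k))) * avg n k - avg n k') \<le> 2 * jump n + 2 * jump (Suc n)"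
proof -
  obtain i where i: "i \<in> vis n 1 k" using vis_nonempty[OF k one_idx] by blast
  let ?hk = "h n k" and ?H = "h (Suc n) 1"
  have j0: "cmod (unit_char (- (\<alpha> * real i)) * avg (Suc n) 1 - avg n k) \<le> jump n"
    by (rule jump_bound[OF k one_idx i])
  have j1: "cmod (unit_char (- (\<alpha> * real (i + ?hk))) * avg (Suc n) 1 - unit_char (- (\<alpha> * real ?hk)) * avg n k) \<le> jump n"
  proof -
    have "- (\<alpha> * real (i + ?hk)) = - (\<alpha> * real ?hk) + - (\<alpha> * real i)" by (simp add: algebra_simps)
    thus ?thesis using rotate_bound[OF j0, of "- (\<alpha> * real ?hk)"] by simp
  qed
  have tri: "cmod (y - w) \<le> d + e" if "cmod (x - y) \<le> d" "cmod (x - w) \<le> e" for x y w :: complex and d e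
    using that norm_triangle_ineq4[of "x - w" "x - y"] by simp
  have D1: "0 \<le> jump (Suc n)" by (rule jump_nonneg)
  show ?thesis
  proof (cases "i + ?hk < ?H")
    case True
    then obtain k' where k': "k' \<in> idx n" "i + ?hk \<in> vis n 1 k'" using return_visit[OF one_idx k i] by blast
    have "cmod (unit_char (- (\<alpha> * real (i + ?hk))) * avg (Suc n) 1 - avg n k') \<le> jump n"
      by (rule jump_bound[OF k'(1) one_idx k'(2)])
    from tri[OF j1 this] D1 k'(1) show ?thesis by (intro bexI[of _ k']) auto
  next
    case False
    have "i + (?hk - 1) < ?H" using vis_add_less[OF i one_idx k, of "?hk - 1"] h_pos[OF k] by simp
    hence H: "i + ?hk = ?H" using False by linarith
    show ?thesis
    proof (cases "idx (Suc n) = {1}")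
      case True
      have "unit_char (- (\<alpha> * real (i + ?hk))) = 1"
        using full_return[OF True nz] unfolding H unit_char_uminus by simp
      hence "cmod (avg (Suc n) 1 - unit_char (- (\<alpha> * real ?hk)) * avg n k) \<le> jump n" using j1 by simp
      from tri[OF this jump_first[OF one_idx]] D1 show ?thesis by (intro bexI[of _ 1]) auto
    next
      case False
      then obtain k2 where k2: "k2 \<in> idx (Suc n)" "k2 \<noteq> 1" using one_idx by blast
      \<comment> \<open>By (KR5) the first tower of level n + 2 contains a block of each type. With
        two types it is strictly higher than its initial block, so another visit follows at time
        \<open>?H\<close>.\<close>
      have "real ?H + real (h (Suc n) k2) = (\<Sum>k\<in>{1, k2}. 1 * real (h (Suc n) k))" using k2(2) by simp
      also have "\<dots> \<le> (\<Sum>k\<in>{1, k2}. real (card (vis (Suc n) 1 k)) * real (h (Suc n) k))"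
        using k2 by (intro sum_mono mult_right_mono card_vis_ge) auto
      also have "\<dots> \<le> real (h (Suc (Suc n)) 1)"
        unfolding h_rec[OF one_idx] using k2 by (intro sum_mono2) auto
      finally have lt: "0 + ?H < h (Suc (Suc n)) 1" using h_pos[OF k2(1)] by simp
      obtain k' where k': "k' \<in> idx (Suc n)" "?H \<in> vis (Suc n) 1 k'"
        using return_visit[OF one_idx one_idx zero_vis[OF one_idx] lt] by auto
      have q1: "cmod (unit_char (- (\<alpha> * real ?H)) * avg (Suc (Suc n)) 1 - avg (Suc n) k') \<le> jump (Suc n)"
        by (rule jump_bound[OF k'(1) one_idx k'(2)])
      have "cmod (unit_char 0 * avg (Suc (Suc n)) 1 - avg (Suc n) 1) \<le> jump (Suc n)"
        using jump_first[OF one_idx, of "Suc n"] by simp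
      from rotate_bound[OF this, of "- (\<alpha> * real ?H)"]
      have q2: "cmod (unit_char (- (\<alpha> * real ?H)) * avg (Suc (Suc n)) 1 - unit_char (- (\<alpha> * real ?H)) * avg (Suc n) 1) \<le> jump (Suc n)"
        by simp
      have q3: "cmod (unit_char (- (\<alpha> * real ?H)) * avg (Suc n) 1 - avg (Suc n) k') \<le> 2 * jump (Suc n)"
        using tri[OF q2 q1] by simp
      have q4: "cmod (avg (Suc n) k' - avg n 1) \<le> jump n" by (rule jump_first[OF k'(1)])
      have "cmod (unit_char (- (\<alpha> * real ?H)) * avg (Suc n) 1 - avg n 1) \<le> 2 * jump (Suc n) + jump n"
        using norm_triangle_mono[OF q3 q4] by simp
      from tri[OF j1[unfolded H] this] show ?thesis by (intro bexI[of _ 1]) auto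
    qed
  qed
qed

text \<open>By \<open>period_defect\<close>, rotating \<open>avg n k\<close> by the phase of
  \<open>h n k\<close> gives nearly an average of the same level, which is itself near
  \<open>avg n k\<close>. As the averages stay away from 0, the phase is near 1.\<close>

lemma summable_V_sq:
  assumes "\<not> (AE x in \<mu>. f x = 0)" shows "summable (\<lambda>n. (V n)\<^sup>2)"
proof -
  obtain c N where c: "0 < c" "\<And>n k. N \<le> n \<Longrightarrow> k \<in> idx n \<Longrightarrow> c \<le> cmod (avg n k)"
    using avg_lower[OF assms] by blast
  \<comment> \<open>The constant is 12 = 2^2 times 3, the 3 coming from the square of a sum of three
    terms. The level is \<open>Suc m\<close> because comparing two averages of one level uses the
    jump from the level below.\<close>
  have bound: "(V (Suc m))\<^sup>2 \<le> 12 / c\<^sup>2 * ((jump m)\<^sup>2 + (jump (Suc m))\<^sup>2 + (jump (Suc (Suc m)))\<^sup>2)" if m: "N \<le> m" for m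
  proof -
    let ?n = "Suc m"
    obtain k where k: "k \<in> idx ?n" "V ?n = dnint (\<alpha> * real (h ?n k))" using V_attained by blast
    have "avg (Suc ?n) 1 \<noteq> 0" using c(2)[of "Suc ?n" 1] c(1) m by auto
    then obtain k' where k': "k' \<in> idx ?n"
        "cmod (unit_char (- (\<alpha> * real (h ?n k))) * avg ?n k - avg ?n k') \<le> 2 * jump ?n + 2 * jump (Suc ?n)"
      using period_defect[OF k(1)] by blast
    have "cmod (avg ?n k' - avg ?n k) \<le> 2 * jump m"
      using norm_triangle_ineq4[of "avg ?n k' - avg m 1" "avg ?n k - avg m 1"]
        jump_first[OF k(1)] jump_first[OF k'(1)] by simp
    hence "cmod (unit_char (- (\<alpha> * real (h ?n k))) * avg ?n k - avg ?n k) \<le> 2 * jump ?n + 2 * jump (Suc ?n) + 2 * jump m"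
      using norm_triangle_mono[OF k'(2), of "avg ?n k' - avg ?n k" "2 * jump m"] by simp
    moreover have "unit_char (- (\<alpha> * real (h ?n k))) * avg ?n k - avg ?n k
        = (unit_char (- (\<alpha> * real (h ?n k))) - 1) * avg ?n k" by (simp add: ring_distribs)
    ultimately have 1: "cmod (unit_char (- (\<alpha> * real (h ?n k))) - 1) * cmod (avg ?n k) \<le> 2 * jump ?n + 2 * jump (Suc ?n) + 2 * jump m"
      by (simp add: norm_mult)
    have "V ?n * c \<le> cmod (unit_char (- (\<alpha> * real (h ?n k))) - 1) * cmod (avg ?n k)"
      using dnint_le_norm_unit_char[of "- (\<alpha> * real (h ?n k))"] c(1) c(2)[of ?n k] k m
      by (intro mult_mono) (auto simp: dnint_uminus)
    with 1 have 2: "V ?n * c \<le> 2 * (jump ?n + jump (Suc ?n) + jump m)" by simp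
    have sq: "(x + y + z)\<^sup>2 \<le> 3 * (x\<^sup>2 + y\<^sup>2 + z\<^sup>2)" for x y z :: real
      using zero_le_power2[of "x - y"] zero_le_power2[of "y - z"] zero_le_power2[of "x - z"]
      by (simp add: power2_eq_square algebra_simps)
    have "(V ?n * c)\<^sup>2 \<le> (2 * (jump ?n + jump (Suc ?n) + jump m))\<^sup>2"
      using 2 V_nonneg c(1) by (intro power_mono) auto
    also have "\<dots> \<le> 4 * (3 * ((jump ?n)\<^sup>2 + (jump (Suc ?n))\<^sup>2 + (jump m)\<^sup>2))"
      unfolding power_mult_distrib using sq[of "jump ?n" "jump (Suc ?n)" "jump m"] by simp
    finally show ?thesis using c(1) by (simp add: field_simps)
  qed
  have "summable (\<lambda>m. 12 / c\<^sup>2 * ((jump m)\<^sup>2 + (jump (Suc m))\<^sup>2 + (jump (Suc (Suc m)))\<^sup>2))"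
    using summable_jump_sq by (intro summable_mult summable_add) (simp_all add: summable_Suc_iff[of "\<lambda>n. (jump n)\<^sup>2"] summable_Suc_iff[of "\<lambda>n. (jump (Suc n))\<^sup>2"])
  hence "summable (\<lambda>m. (V (Suc m))\<^sup>2)"
  proof (rule summable_comparison_test'[where N = N])
    fix m assume "N \<le> m"
    from bound[OF this]
    show "norm ((V (Suc m))\<^sup>2) \<le> 12 / c\<^sup>2 * ((jump m)\<^sup>2 + (jump (Suc m))\<^sup>2 + (jump (Suc (Suc m)))\<^sup>2)"
      by (simp only: real_norm_def abs_power2)
  qed
  thus ?thesis by (simp add: summable_Suc_iff[of "\<lambda>n. (V n)\<^sup>2"])
qed

end

lemma L2_eigenvalue_imp_summable:
  assumes "L2_eigenvalue \<mu> T (unit_char \<alpha>)" shows "summable (\<lambda>n. (V n)\<^sup>2)"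
  using assms summable_V_sq unfolding L2_eigenvalue_def by metis

end

section \<open>Measurable eigenvalues: sufficiency\<close>

text \<open>Schur's test: each row of the kernel has sum at most two geometric series, and products
  are bounded by half the sum of squares.\<close>

lemma geometric_quadratic_form_le:
  fixes x :: "nat \<Rightarrow> real"
  assumes A: "finite A" and \<theta>: "0 \<le> \<theta>" "\<theta> < 1"
  shows "(\<Sum>n\<in>A. \<Sum>m\<in>A. \<theta> ^ nat \<bar>int n - int m\<bar> * (x n * x m)) \<le> 2 / (1 - \<theta>) * (\<Sum>n\<in>A. (x n)\<^sup>2)"
proof -
  let ?t = "\<lambda>n m. \<theta> ^ nat \<bar>int n - int m\<bar>"
  have geo: "(\<Sum>j\<in>J. \<theta> ^ j) \<le> 1 / (1 - \<theta>)" if "finite J" for J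
    using sum_le_suminf[OF summable_geometric[of \<theta>] that] suminf_geometric[of \<theta>] \<theta> by simp
  have row: "(\<Sum>m\<in>A. ?t n m) \<le> 2 / (1 - \<theta>)" for n
  proof -
    have "(\<Sum>m\<in>A. ?t n m) = (\<Sum>m\<in>A \<inter> {..n}. ?t n m) + (\<Sum>m\<in>A - {..n}. ?t n m)"
      by (rule sum.Int_Diff[OF A])
    also have "(\<Sum>m\<in>A \<inter> {..n}. ?t n m) = (\<Sum>j\<in>(\<lambda>m. n - m) ` (A \<inter> {..n}). \<theta> ^ j)"
      by (subst sum.reindex) (auto simp: inj_on_def intro!: sum.cong arg_cong[of _ _ "\<lambda>j. \<theta> ^ j"])
    also have "(\<Sum>m\<in>A - {..n}. ?t n m) = (\<Sum>j\<in>(\<lambda>m. m - n) ` (A - {..n}). \<theta> ^ j)"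
      by (subst sum.reindex) (auto simp: inj_on_def intro!: sum.cong arg_cong[of _ _ "\<lambda>j. \<theta> ^ j"])
    finally show ?thesis
      using geo[of "(\<lambda>m. n - m) ` (A \<inter> {..n})"] geo[of "(\<lambda>m. m - n) ` (A - {..n})"] A by simp
  qed
  have sym: "?t n m = ?t m n" for n m by (simp add: abs_minus_commute)
  have "(\<Sum>n\<in>A. \<Sum>m\<in>A. ?t n m * (x n * x m))
      \<le> (\<Sum>n\<in>A. \<Sum>m\<in>A. ?t n m * (x n)\<^sup>2 / 2 + ?t m n * (x m)\<^sup>2 / 2)"
  proof (intro sum_mono)
    fix n m
    have "x n * x m \<le> ((x n)\<^sup>2 + (x m)\<^sup>2) / 2"
      using zero_le_power2[of "x n - x m"] by (simp add: power2_diff)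
    hence "?t n m * (x n * x m) \<le> ?t n m * (((x n)\<^sup>2 + (x m)\<^sup>2) / 2)"
      using \<theta> by (intro mult_left_mono) auto
    thus "?t n m * (x n * x m) \<le> ?t n m * (x n)\<^sup>2 / 2 + ?t m n * (x m)\<^sup>2 / 2"
      unfolding sym[of m n] by (simp add: field_simps)
  qed
  also have "\<dots> = (\<Sum>n\<in>A. \<Sum>m\<in>A. ?t n m * (x n)\<^sup>2 / 2) + (\<Sum>n\<in>A. \<Sum>m\<in>A. ?t m n * (x m)\<^sup>2 / 2)"
    by (simp only: sum.distrib)
  also have "(\<Sum>n\<in>A. \<Sum>m\<in>A. ?t m n * (x m)\<^sup>2 / 2) = (\<Sum>n\<in>A. \<Sum>m\<in>A. ?t n m * (x n)\<^sup>2 / 2)"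
    by (rule sum.swap)
  also have "(\<Sum>n\<in>A. \<Sum>m\<in>A. ?t n m * (x n)\<^sup>2 / 2) + (\<Sum>n\<in>A. \<Sum>m\<in>A. ?t n m * (x n)\<^sup>2 / 2)
      = (\<Sum>n\<in>A. (\<Sum>m\<in>A. ?t n m) * (x n)\<^sup>2)"
    by (simp add: sum_distrib_right flip: sum.distrib) (simp add: mult.commute)
  also have "\<dots> \<le> (\<Sum>n\<in>A. 2 / (1 - \<theta>) * (x n)\<^sup>2)"
    by (intro sum_mono mult_right_mono row) auto
  finally show ?thesis by (simp add: sum_distrib_left)
qed

text \<open>Along r the squared increments have mean at most 4^(-j); weighted by 2^j they remain
  summable in mean, hence almost everywhere. The inequality t \<le> t^2 + 1 with t = 2^j
  \<open>\<bar>?d j\<bar>\<close> then gives absolute summability of the increments.\<close>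

lemma (in prob_space) L2_Cauchy_imp_AE_convergent_subseq:
  fixes G :: "nat \<Rightarrow> 'a \<Rightarrow> real"
  assumes [measurable]: "\<And>n. G n \<in> borel_measurable M"
    and int: "\<And>n m. integrable M (\<lambda>x. (G m x - G n x)\<^sup>2)"
    and cauchy: "\<And>\<epsilon>. 0 < \<epsilon> \<Longrightarrow> \<exists>N. \<forall>n\<ge>N. \<forall>m\<ge>n. expectation (\<lambda>x. (G m x - G n x)\<^sup>2) \<le> \<epsilon>"
  shows "\<exists>r. strict_mono r \<and> (AE x in M. convergent (\<lambda>n. G (r n) x))"
proof -
  have "\<forall>j. \<exists>N. \<forall>n\<ge>N. \<forall>m\<ge>n. expectation (\<lambda>x. (G m x - G n x)\<^sup>2) \<le> (1 / 4) ^ j"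
    by (intro allI cauchy) simp
  then obtain N where N: "\<And>j n m. N j \<le> n \<Longrightarrow> n \<le> m \<Longrightarrow> expectation (\<lambda>x. (G m x - G n x)\<^sup>2) \<le> (1 / 4) ^ j"
    by metis
  \<comment> \<open>Summing the thresholds and adding j makes r strictly increasing and still at
    least \<open>N j\<close>.\<close>
  define r where "r j = (\<Sum>i\<le>j. N i) + j" for j
  have r: "strict_mono r" by (rule strict_mono_Suc_iff[THEN iffD2]) (simp add: r_def)
  have Nr: "N j \<le> r j" for j
    using member_le_sum[of j "{..j}" N] by (simp add: r_def)
  define \<psi> where "\<psi> j x = 2 ^ j * (G (r (Suc j)) x - G (r j) x)\<^sup>2" for j x
  have [measurable]: "\<psi> j \<in> borel_measurable M" for j unfolding \<psi>_def by measurable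
  have \<psi>_nonneg: "0 \<le> \<psi> j x" for j x by (simp add: \<psi>_def)
  have nn: "(\<integral>\<^sup>+x. ennreal (\<psi> j x) \<partial>M) \<le> ennreal ((1 / 2) ^ j)" for j
  proof -
    have "(\<integral>\<^sup>+x. ennreal (\<psi> j x) \<partial>M) = ennreal (expectation (\<psi> j))"
      unfolding \<psi>_def using int by (intro nn_integral_eq_integral) auto
    also have "expectation (\<psi> j) = 2 ^ j * expectation (\<lambda>x. (G (r (Suc j)) x - G (r j) x)\<^sup>2)"
      unfolding \<psi>_def by simp
    also have "\<dots> \<le> 2 ^ j * (1 / 4) ^ j"
      using r by (intro mult_left_mono N Nr) (auto simp: strict_mono_def intro: less_imp_le)
    also have "\<dots> = (1 / 2) ^ j" by (simp flip: power_mult_distrib)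
    finally show ?thesis by (simp add: ennreal_leI)
  qed
  have "(\<integral>\<^sup>+x. (\<Sum>j. ennreal (\<psi> j x)) \<partial>M) = (\<Sum>j. \<integral>\<^sup>+x. ennreal (\<psi> j x) \<partial>M)"
    by (rule nn_integral_suminf) measurable
  also have "\<dots> \<le> (\<Sum>j. ennreal ((1 / 2) ^ j))" by (intro suminf_le nn) auto
  also have "\<dots> = ennreal (\<Sum>j. (1 / 2) ^ j)" by (rule suminf_ennreal2) (auto intro: summable_geometric)
  also have "\<dots> < \<infinity>" by simp
  finally have "AE x in M. (\<Sum>j. ennreal (\<psi> j x)) \<noteq> \<infinity>" by (intro nn_integral_PInf_AE) auto
  hence "AE x in M. convergent (\<lambda>n. G (r n) x)"
  proof eventually_elim
    case (elim x)
    let ?d = "\<lambda>j. G (r (Suc j)) x - G (r j) x"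
    have "summable (\<lambda>j. \<psi> j x)" using elim \<psi>_nonneg by (intro summable_suminf_not_top) auto
    hence s: "summable (\<lambda>j. \<psi> j x + (1 / 2) ^ j)" by (intro summable_add summable_geometric) auto
    have "summable ?d"
    proof (rule summable_comparison_test'[OF s])
      fix j
      have "0 \<le> (2 ^ j * \<bar>?d j\<bar> - 1)\<^sup>2" by simp
      hence "2 * (2 ^ j * \<bar>?d j\<bar>) \<le> (2 ^ j * \<bar>?d j\<bar>)\<^sup>2 + 1" by (simp add: power2_diff)
      moreover have "0 \<le> 2 ^ j * \<bar>?d j\<bar>" by simp
      ultimately have "2 ^ j * \<bar>?d j\<bar> \<le> (2 ^ j * \<bar>?d j\<bar>)\<^sup>2 + 1" by linarith
      also have "\<dots> = 2 ^ j * (\<psi> j x + (1 / 2) ^ j)"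
      proof -
        have "(2 ^ j * \<bar>?d j\<bar>)\<^sup>2 = 2 ^ j * \<psi> j x"
          by (simp only: \<psi>_def power_mult_distrib power2_abs power2_eq_square[of "2 ^ j"] mult.assoc)
        moreover have "(2::real) ^ j * (1 / 2) ^ j = 1" by (simp flip: power_mult_distrib)
        ultimately show ?thesis by (simp only: distrib_left)
      qed
      finally have "\<bar>?d j\<bar> \<le> \<psi> j x + (1 / 2) ^ j" by simp
      thus "norm (?d j) \<le> \<psi> j x + (1 / 2) ^ j" by simp
    qed
    hence "convergent (\<lambda>n. \<Sum>j<n. ?d j)" by (simp add: summable_iff_convergent)
    hence "convergent (\<lambda>n. (G (r n) x - G (r 0) x) + G (r 0) x)"
      unfolding sum_lessThan_telescope[of "\<lambda>j. G (r j) x"] by (intro convergent_add convergent_const)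
    thus ?case by simp
  qed
  thus ?thesis using r by blast
qed

context kr_measure
begin

section \<open>Centred residues and contraction of tower averages\<close>

definition res :: "nat \<Rightarrow> 'a \<Rightarrow> real" where
  "res n x = \<alpha> * real (step n x) - of_int (round (\<alpha> * real (step n x)))"

lemma res_bound: "x \<in> X \<Longrightarrow> \<bar>res n x\<bar> \<le> L * V n"
  using dnint_step[of x n] by (simp add: res_def dnint_def)

lemma step_measurable [measurable]: "step n \<in> measurable \<mu> (count_space UNIV)"
  unfolding step_def by measurable

lemma res_measurable [measurable]: "res n \<in> borel_measurable \<mu>"
  unfolding res_def by measurable

lemma integrable_bounded:
  fixes g :: "'a \<Rightarrow> real"
  assumes "g \<in> borel_measurable \<mu>" "\<And>x. x \<in> X \<Longrightarrow> \<bar>g x\<bar> \<le> c" shows "integrable \<mu> g"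
  using assms by (intro integrable_const_bound[of _ c]) (auto intro!: AE_I2)

lemma res_integrable: "integrable \<mu> (res n)"
  by (rule integrable_bounded[OF res_measurable res_bound])

text \<open>Measurability with respect to the finite partition of level m, in pointwise
  form.\<close>

definition lev :: "nat \<Rightarrow> ('a \<Rightarrow> real) \<Rightarrow> bool" where
  "lev m g \<longleftrightarrow> (\<forall>x\<in>X. \<forall>y\<in>cell m x. g y = g x)"

lemma lev_mono:
  assumes "lev m g" "m \<le> m'" shows "lev m' g"
  unfolding lev_def
proof (intro ballI)
  fix x y assume "x \<in> X" "y \<in> cell m' x"
  thus "g y = g x" using cell_antimono[OF _ assms(2), of x] assms(1) unfolding lev_def by blast
qed

lemma lev_res: assumes "n < m" shows "lev m (res n)"
  unfolding lev_def
proof (intro ballI)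
  fix x y assume x: "x \<in> X" and y: "y \<in> cell m x"
  have "ret n' y = ret n' x" if "n' \<le> m" for n'
    using address_eq(2)[OF address(1,2)[OF x]] y cell_antimono[OF x that] by blast
  thus "res n y = res n x" using assms by (simp add: res_def step_def)
qed

definition pt :: "nat \<Rightarrow> nat \<Rightarrow> nat \<Rightarrow> 'a" where
  "pt m k j = (SOME x. x \<in> atom m k j)"

lemma pt_atom: "k \<in> idx m \<Longrightarrow> pt m k j \<in> atom m k j"
  unfolding pt_def using atom_ne[of k m j] some_in_eq by blast

lemma lev_pt:
  assumes "lev m g" "k \<in> idx m" "j < h m k" "x \<in> atom m k j" shows "g x = g (pt m k j)"
proof -
  have p: "pt m k j \<in> atom m k j" using assms(2) by (rule pt_atom)
  hence "pt m k j \<in> X" using atom_sub by blast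
  thus ?thesis using assms(1,4) address_eq[OF assms(2,3) p] unfolding lev_def by auto
qed

definition tsum :: "('a \<Rightarrow> real) \<Rightarrow> nat \<Rightarrow> nat \<Rightarrow> real" where
  "tsum g m k = (\<Sum>j<h m k. g (pt m k j))"

lemma tsum_rec:
  assumes g: "lev m g" and l: "l \<in> idx (Suc m)"
  shows "tsum g (Suc m) l = (\<Sum>k\<in>idx m. real (card (vis m l k)) * tsum g m k)"
proof -
  have "g (pt (Suc m) l (i + j)) = g (pt m k j)" if "k \<in> idx m" "i \<in> vis m l k" "j < h m k" for k i j
    using lev_pt[OF g that(1,3)] atom_add_sub[OF that(2)] pt_atom[OF l] by blast
  hence "tsum g (Suc m) l = (\<Sum>k\<in>idx m. \<Sum>i\<in>vis m l k. tsum g m k)"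
    unfolding tsum_def sum_tower[OF l] by (intro sum.cong refl) auto
  thus ?thesis by simp
qed

lemma integral_lev_mult:
  assumes g: "lev m g" and gi: "integrable \<mu> (\<lambda>x. g x * u x)"
  shows "(LINT x|\<mu>. g x * u x) = (\<Sum>k\<in>idx m. \<Sum>j<h m k. g (pt m k j) * (LINT x:atom m k j|\<mu>. u x))"
  unfolding integral_split_atoms[OF gi, of m]
proof (intro sum.cong refl)
  fix k j assume k: "k \<in> idx m" and j: "j \<in> {..<h m k}"
  have "(LINT x:atom m k j|\<mu>. g x * u x) = (LINT x|\<mu>. g (pt m k j) * (indicator (atom m k j) x *\<^sub>R u x))"
    unfolding set_lebesgue_integral_def
  proof (intro Bochner_Integration.integral_cong refl)
    fix x
    show "indicator (atom m k j) x *\<^sub>R (g x * u x) = g (pt m k j) * (indicator (atom m k j) x *\<^sub>R u x)"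
      using lev_pt[OF g k, of j x] j by (auto simp: indicator_def)
  qed
  thus "(LINT x:atom m k j|\<mu>. g x * u x) = g (pt m k j) * (LINT x:atom m k j|\<mu>. u x)"
    by (simp only: set_lebesgue_integral_def integral_mult_right_zero)
qed

lemma integral_lev:
  assumes g: "lev m g" and gi: "integrable \<mu> g"
  shows "(LINT x|\<mu>. g x) = (\<Sum>k\<in>idx m. b m k * tsum g m k)"
proof -
  have "(LINT x|\<mu>. g x) = (\<Sum>k\<in>idx m. \<Sum>j<h m k. g (pt m k j) * (LINT x:atom m k j|\<mu>. 1))"
    using integral_lev_mult[OF g, of "\<lambda>_. 1"] gi by simp
  also have "\<dots> = (\<Sum>k\<in>idx m. b m k * tsum g m k)"
    unfolding tsum_def sum_distrib_left
    by (intro sum.cong refl) (simp add: set_integral_one measure_preim)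
  finally show ?thesis .
qed

text \<open>The tower averages at level \<open>m + 1\<close> are averages of those at level \<open>m\<close>, with weights
  \<open>card (vis m l k) * h m k / h (Suc m) l\<close> that are bounded below by \<open>1 / L\<close>: a Doeblin condition.\<close>

lemma tower_average_contraction_lower:
  assumes g: "lev m g" and lo: "\<And>k. k \<in> idx m \<Longrightarrow> p * real (h m k) \<le> tsum g m k" and l: "l \<in> idx (Suc m)"
  shows "(p + (tsum g m 1 / real (h m 1) - p) / L) * real (h (Suc m) l) \<le> tsum g (Suc m) l"
proof -
  let ?h = "real (h m 1)"
  let ?\<phi> = "tsum g m 1 / ?h"
  have h1: "0 < ?h" using h_pos[OF one_idx] by simp
  have ph: "0 \<le> ?\<phi> - p" using lo[OF one_idx] h1 by (simp add: field_simps)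
  have "real (h (Suc m) l) / L * (?\<phi> - p) \<le> ?h * (?\<phi> - p)"
    using LR[OF l one_idx] L_ge by (intro mult_right_mono ph) (simp add: field_simps)
  also have "\<dots> = 1 * (tsum g m 1 - p * ?h)" using h1 by (simp add: field_simps)
  also have "\<dots> \<le> real (card (vis m l 1)) * (tsum g m 1 - p * ?h)"
    using lo[OF one_idx] by (intro mult_right_mono card_vis_ge l one_idx) simp
  also have "\<dots> \<le> (\<Sum>k\<in>idx m. real (card (vis m l k)) * (tsum g m k - p * real (h m k)))"
    using lo by (intro member_le_sum[OF one_idx]) auto
  also have "\<dots> = tsum g (Suc m) l - p * real (h (Suc m) l)"
    unfolding tsum_rec[OF g l] h_rec[OF l]
    by (simp add: right_diff_distrib sum_subtractf sum_distrib_left mult_ac)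
  finally show ?thesis by (simp add: field_simps)
qed

lemma tsum_uminus: "tsum (\<lambda>x. - g x) m k = - tsum g m k"
  by (simp add: tsum_def sum_negf)

lemma tower_average_contraction_upper:
  assumes g: "lev m g" and hi: "\<And>k. k \<in> idx m \<Longrightarrow> tsum g m k \<le> q * real (h m k)" and l: "l \<in> idx (Suc m)"
  shows "tsum g (Suc m) l \<le> (q + (tsum g m 1 / real (h m 1) - q) / L) * real (h (Suc m) l)"
proof -
  have "lev m (\<lambda>x. - g x)" using g by (simp add: lev_def)
  from tower_average_contraction_lower[OF this _ l, of "- q"] hi
  have "(- q + (- tsum g m 1 / real (h m 1) + q) / L) * real (h (Suc m) l) \<le> - tsum g (Suc m) l"
    by (simp add: tsum_uminus)
  moreover have "- q + (- tsum g m 1 / real (h m 1) + q) / L = - (q + (tsum g m 1 / real (h m 1) - q) / L)"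
    by (simp add: diff_divide_distrib add_divide_distrib)
  ultimately have "- ((q + (tsum g m 1 / real (h m 1) - q) / L) * real (h (Suc m) l)) \<le> - tsum g (Suc m) l"
    by (simp only: mult_minus_left)
  thus ?thesis by (simp only: neg_le_iff_le)
qed

text \<open>The averages lie in an interval [p, q], initially [-c, c], which shrinks by the factor 1
  - 1/L with each level.\<close>

lemma tower_average_oscillation:
  assumes g: "lev m g" and gb: "\<And>x. x \<in> X \<Longrightarrow> \<bar>g x\<bar> \<le> c"
  shows "\<exists>p q. q - p \<le> (1 - 1 / L) ^ d * (2 * c) \<and>
     (\<forall>k\<in>idx (m + d). p * real (h (m + d) k) \<le> tsum g (m + d) k \<and> tsum g (m + d) k \<le> q * real (h (m + d) k))"
proof (induction d)
  case 0
  have "- c * real (h m k) \<le> tsum g m k \<and> tsum g m k \<le> c * real (h m k)" if k: "k \<in> idx m" for k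
  proof -
    have "\<bar>tsum g m k\<bar> \<le> (\<Sum>j<h m k. \<bar>g (pt m k j)\<bar>)" unfolding tsum_def by (rule sum_abs)
    also have "\<dots> \<le> (\<Sum>j<h m k. c)" using pt_atom[OF k] atom_sub by (intro sum_mono gb) blast
    finally have "\<bar>tsum g m k\<bar> \<le> c * real (h m k)" by (simp add: mult.commute)
    thus ?thesis by linarith
  qed
  thus ?case by (intro exI[of _ "- c"] exI[of _ c]) simp
next
  case (Suc d)
  then obtain p q where pq: "q - p \<le> (1 - 1 / L) ^ d * (2 * c)"
      "\<And>k. k \<in> idx (m + d) \<Longrightarrow> p * real (h (m + d) k) \<le> tsum g (m + d) k"
      "\<And>k. k \<in> idx (m + d) \<Longrightarrow> tsum g (m + d) k \<le> q * real (h (m + d) k)" by blast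
  have g': "lev (m + d) g" using lev_mono[OF g] by simp
  let ?\<phi> = "tsum g (m + d) 1 / real (h (m + d) 1)"
  \<comment> \<open>Both ends move the fraction 1/L of the way towards the same point, the average
    over the first tower.\<close>
  let ?p = "p + (?\<phi> - p) / L" and ?q = "q + (?\<phi> - q) / L"
  have "?q - ?p = (1 - 1 / L) * (q - p)" using L_ge by (simp add: field_simps)
  also have "\<dots> \<le> (1 - 1 / L) * ((1 - 1 / L) ^ d * (2 * c))"
    using L_ge by (intro mult_left_mono pq(1)) simp
  finally have "?q - ?p \<le> (1 - 1 / L) ^ Suc d * (2 * c)" by (simp add: mult.assoc)
  moreover have "\<forall>k\<in>idx (m + Suc d). ?p * real (h (m + Suc d) k) \<le> tsum g (m + Suc d) k
      \<and> tsum g (m + Suc d) k \<le> ?q * real (h (m + Suc d) k)"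
    using tower_average_contraction_lower[OF g' pq(2)] tower_average_contraction_upper[OF g' pq(3)] by simp
  ultimately show ?case by blast
qed

text \<open>The integral is a convex combination of the tower averages, with weights the tower
  masses, so it lies in the same interval [p, q].\<close>

lemma tower_average_near_integral:
  assumes g: "lev m g" and gb: "\<And>x. x \<in> X \<Longrightarrow> \<bar>g x\<bar> \<le> c" and gi: "integrable \<mu> g"
    and k: "k \<in> idx (m + d)"
  shows "\<bar>tsum g (m + d) k - real (h (m + d) k) * (LINT x|\<mu>. g x)\<bar> \<le> (1 - 1 / L) ^ d * (2 * c) * real (h (m + d) k)"
proof -
  obtain p q where pq: "q - p \<le> (1 - 1 / L) ^ d * (2 * c)"
      "\<And>k. k \<in> idx (m + d) \<Longrightarrow> p * real (h (m + d) k) \<le> tsum g (m + d) k"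
      "\<And>k. k \<in> idx (m + d) \<Longrightarrow> tsum g (m + d) k \<le> q * real (h (m + d) k)"
    using tower_average_oscillation[OF g gb, of d] by blast
  let ?E = "LINT x|\<mu>. g x" and ?h = "\<lambda>k. real (h (m + d) k)"
  have E: "?E = (\<Sum>k\<in>idx (m + d). b (m + d) k * tsum g (m + d) k)"
    by (rule integral_lev[OF lev_mono[OF g] gi]) simp
  have w: "(\<Sum>k\<in>idx (m + d). b (m + d) k * (s * ?h k)) = s" for s
  proof -
    have "(\<Sum>k\<in>idx (m + d). b (m + d) k * (s * ?h k)) = s * (\<Sum>k\<in>idx (m + d). ?h k * b (m + d) k)"
      unfolding sum_distrib_left by (intro sum.cong) (auto simp: mult_ac)
    thus ?thesis by (simp add: weights_sum)
  qed
  have "(\<Sum>k\<in>idx (m + d). b (m + d) k * (p * ?h k)) \<le> ?E"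
    unfolding E by (intro sum_mono mult_left_mono pq(2)) auto
  moreover have "?E \<le> (\<Sum>k\<in>idx (m + d). b (m + d) k * (q * ?h k))"
    unfolding E by (intro sum_mono mult_left_mono pq(3)) auto
  moreover note w[of p] w[of q]
  ultimately have "p * ?h k \<le> ?h k * ?E" "?h k * ?E \<le> q * ?h k"
    by (simp_all add: mult.commute mult_right_mono)
  hence "\<bar>tsum g (m + d) k - ?h k * ?E\<bar> \<le> (q - p) * ?h k"
    using pq(2)[OF k] pq(3)[OF k] by (simp add: left_diff_distrib abs_le_iff)
  also have "\<dots> \<le> (1 - 1 / L) ^ d * (2 * c) * ?h k" by (intro mult_right_mono pq(1)) simp
  finally show ?thesis .
qed

lemma ret_Tn:
  assumes "x \<in> X" "j \<le> ret n x" shows "ret n ((T ^^ j) x) = ret n x - j"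
proof -
  have "(T ^^ j) x \<in> atom n (tow n x) (ret n x - j)"
    using preim_add[OF assms(1), of "ret n x - j" j] address(3)[OF assms(1), of n] assms(2) by simp
  thus ?thesis using address_eq(2)[OF address(1)[OF assms(1)]] address(2)[OF assms(1), of n] by simp
qed

text \<open>Moving down j floors to the base of the tower of level m lowers the return times of
  levels m and m + 1 by the same j. Hence \<open>res m\<close> has equal integrals over all floors
  of a tower (\<open>set_integral_res\<close>).\<close>

lemma res_Tn:
  assumes "k \<in> idx m" "j < h m k" "x \<in> atom m k j" shows "res m ((T ^^ j) x) = res m x"
proof -
  have x: "x \<in> X" using assms(3) atom_sub by blast
  have j: "ret m x = j" using address_eq(2)[OF assms] .
  have 1: "ret m ((T ^^ j) x) = 0" using ret_Tn[OF x, of j m] j by simp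
  have e: "ret (Suc m) x = step m x + j" using step_eq[OF x, of m] j by simp
  have 2: "ret (Suc m) ((T ^^ j) x) = step m x" using ret_Tn[OF x, of j "Suc m"] unfolding e by simp
  have "step m ((T ^^ j) x) = step m x" unfolding step_def[of m "(T ^^ j) x"] 1 2 by simp
  thus ?thesis by (simp add: res_def)
qed

lemma set_integral_res:
  assumes k: "k \<in> idx m" and j: "j < h m k"
  shows "(LINT x:atom m k j|\<mu>. res m x) = (LINT x:B m k|\<mu>. res m x)"
proof -
  have "(LINT x:atom m k j|\<mu>. res m x) = (LINT x:atom m k j|\<mu>. res m ((T ^^ j) x))"
    unfolding set_lebesgue_integral_def
    by (intro Bochner_Integration.integral_cong refl) (use res_Tn[OF k j] in \<open>auto simp: indicator_def\<close>)
  also have "\<dots> = (LINT x:B m k|\<mu>. res m x)" using k by (intro set_integral_compose_Tn) auto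
  finally show ?thesis .
qed

section \<open>Decay of correlations and almost everywhere convergence\<close>

definition cres :: "nat \<Rightarrow> 'a \<Rightarrow> real" where
  "cres n x = res n x - expectation (res n)"

lemma expectation_res_bound: "\<bar>expectation (res n)\<bar> \<le> L * V n"
proof -
  have "\<bar>expectation (res n)\<bar> \<le> expectation (\<lambda>x. \<bar>res n x\<bar>)" by (rule integral_abs_bound)
  also have "\<dots> \<le> expectation (\<lambda>_. L * V n)"
    using res_integrable by (intro integral_mono) (auto simp: res_bound)
  finally show ?thesis using prob_space by simp
qed

lemma cres_bound: "x \<in> X \<Longrightarrow> \<bar>cres n x\<bar> \<le> 2 * L * V n"
  using res_bound[of x n] expectation_res_bound[of n] unfolding cres_def by linarith

lemma cres_measurable [measurable]: "cres n \<in> borel_measurable \<mu>"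
  unfolding cres_def by measurable

lemma cres_prod_bound: "x \<in> X \<Longrightarrow> \<bar>cres n x * cres m x\<bar> \<le> (2 * L * V n) * (2 * L * V m)"
  unfolding abs_mult using V_nonneg[of n] L_ge by (intro mult_mono cres_bound) auto

lemma cres_prod_integrable: "integrable \<mu> (\<lambda>x. cres n x * cres m x)"
  by (rule integrable_bounded[OF _ cres_prod_bound]) measurable

lemma expectation_cres: "expectation (cres n) = 0"
  unfolding cres_def using res_integrable prob_space by simp

lemma set_integral_res_bound:
  assumes k: "k \<in> idx m" shows "\<bar>LINT x:B m k|\<mu>. res m x\<bar> \<le> L * V m * b m k"
proof -
  have "\<bar>LINT x:B m k|\<mu>. res m x\<bar> \<le> expectation (\<lambda>x. \<bar>indicator (B m k) x *\<^sub>R res m x\<bar>)"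
    unfolding set_lebesgue_integral_def by (rule integral_abs_bound)
  also have "\<dots> \<le> expectation (\<lambda>x. L * V m * indicator (B m k) x)"
  proof (intro integral_mono integrable_abs integrable_mult_indicator res_integrable B_sets k integrable_mult_right)
    show "integrable \<mu> (indicator (B m k) :: 'a \<Rightarrow> real)"
      using k by (intro integrable_real_indicator) (auto simp: emeasure_eq_measure)
  qed (auto simp: indicator_def res_bound)
  also have "\<dots> = L * V m * b m k"
    using set_integral_one[OF B_sets[OF k]] by (simp add: set_lebesgue_integral_def)
  finally show ?thesis .
qed

text \<open>The earlier residue is constant on atoms of the later level, while the later one has
  equal integrals over the floors of a tower. The correlation becomes a sum of tower sums times base
  integrals, and d contractions make the tower sums small.\<close>

lemma correlation_later:
  "\<bar>expectation (\<lambda>x. cres n x * cres (Suc n + d) x)\<bar> \<le> 2 * L\<^sup>2 * (1 - 1 / L) ^ d * (V n * V (Suc n + d))"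
proof -
  let ?m = "Suc n + d"
  have lev: "lev ?m (cres n)" using lev_res[of n ?m] by (simp add: lev_def cres_def)
  have i: "integrable \<mu> (\<lambda>x. cres n x * res ?m x)"
  proof (rule integrable_bounded)
    fix x assume "x \<in> X"
    thus "\<bar>cres n x * res ?m x\<bar> \<le> (2 * L * V n) * (L * V ?m)"
      unfolding abs_mult using V_nonneg[of n] L_ge by (intro mult_mono cres_bound res_bound) auto
  qed measurable
  have ci: "integrable \<mu> (cres n)" by (rule integrable_bounded[OF cres_measurable cres_bound])
  \<comment> \<open>Centring the earlier factor suffices: the mean of the later one multiplies an
    expectation that is 0.\<close>
  have "expectation (\<lambda>x. cres n x * cres ?m x) = expectation (\<lambda>x. cres n x * res ?m x - expectation (res ?m) * cres n x)"
    unfolding cres_def[of ?m] by (simp add: algebra_simps)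
  also have "\<dots> = expectation (\<lambda>x. cres n x * res ?m x)"
    using i ci by (simp add: expectation_cres)
  also have "\<dots> = (\<Sum>k\<in>idx ?m. \<Sum>j<h ?m k. cres n (pt ?m k j) * (LINT x:atom ?m k j|\<mu>. res ?m x))"
    by (rule integral_lev_mult[OF lev i])
  also have "\<dots> = (\<Sum>k\<in>idx ?m. tsum (cres n) ?m k * (LINT x:B ?m k|\<mu>. res ?m x))"
    unfolding tsum_def sum_distrib_right by (intro sum.cong refl) (simp add: set_integral_res)
  finally have "\<bar>expectation (\<lambda>x. cres n x * cres ?m x)\<bar>
      \<le> (\<Sum>k\<in>idx ?m. \<bar>tsum (cres n) ?m k\<bar> * \<bar>LINT x:B ?m k|\<mu>. res ?m x\<bar>)"
    by (simp only: flip: abs_mult) (rule sum_abs)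
  also have "\<dots> \<le> (\<Sum>k\<in>idx ?m. ((1 - 1 / L) ^ d * (2 * (L * V n)) * real (h ?m k)) * (L * V ?m * b ?m k))"
  proof (intro sum_mono mult_mono set_integral_res_bound)
    fix k assume k: "k \<in> idx ?m"
    have "tsum (cres n) ?m k = tsum (res n) ?m k - real (h ?m k) * expectation (res n)"
      by (simp add: tsum_def cres_def sum_subtractf)
    thus "\<bar>tsum (cres n) ?m k\<bar> \<le> (1 - 1 / L) ^ d * (2 * (L * V n)) * real (h ?m k)"
      using tower_average_near_integral[OF lev_res[of n "Suc n"] res_bound res_integrable, of k d] k by simp
    show "0 \<le> (1 - 1 / L) ^ d * (2 * (L * V n)) * real (h ?m k)"
      using L_ge V_nonneg[of n] by (intro mult_nonneg_nonneg zero_le_power) auto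
  qed auto
  also have "\<dots> = (\<Sum>k\<in>idx ?m. 2 * L\<^sup>2 * (1 - 1 / L) ^ d * (V n * V ?m) * (real (h ?m k) * b ?m k))"
    by (intro sum.cong refl) (simp add: power2_eq_square mult_ac)
  also have "\<dots> = 2 * L\<^sup>2 * (1 - 1 / L) ^ d * (V n * V ?m) * (\<Sum>k\<in>idx ?m. real (h ?m k) * b ?m k)"
    by (rule sum_distrib_left[symmetric])
  finally show ?thesis unfolding weights_sum by simp
qed

text \<open>Off the diagonal one power of \<theta> is gained at the price of a factor 2, because L
  \<ge> 2 gives \<theta> \<ge> 1/2; on the diagonal the pointwise bound yields the same constant 4
  L^2.\<close>

lemma correlation:
  "expectation (\<lambda>x. cres n x * cres m x) \<le> 4 * L\<^sup>2 * ((1 - 1 / L) ^ nat \<bar>int n - int m\<bar> * (V n * V m))"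
proof -
  let ?\<theta> = "1 - 1 / L"
  have \<theta>: "1 / 2 \<le> ?\<theta>" using L_ge by (simp add: field_simps)
  have lt: "expectation (\<lambda>x. cres n x * cres m x) \<le> 4 * L\<^sup>2 * (?\<theta> ^ nat \<bar>int n - int m\<bar> * (V n * V m))"
    if nm: "n < m" for n m
  proof -
    obtain d where d: "m = Suc n + d" using less_imp_Suc_add[OF nm] by auto
    have e: "nat \<bar>int n - int m\<bar> = Suc d" using d by simp
    have "1 * ?\<theta> ^ d \<le> 2 * ?\<theta> * ?\<theta> ^ d" using \<theta> by (intro mult_right_mono) auto
    hence "?\<theta> ^ d \<le> 2 * ?\<theta> ^ Suc d" by (simp only: power_Suc mult.assoc mult_1)
    hence "2 * L\<^sup>2 * ?\<theta> ^ d * (V n * V m) \<le> 2 * L\<^sup>2 * (2 * ?\<theta> ^ Suc d) * (V n * V m)"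
      by (intro mult_right_mono mult_left_mono) (auto simp: V_nonneg)
    moreover have "expectation (\<lambda>x. cres n x * cres m x) \<le> 2 * L\<^sup>2 * ?\<theta> ^ d * (V n * V m)"
      using order_trans[OF abs_ge_self correlation_later[of n d]] by (simp only: d)
    ultimately have "expectation (\<lambda>x. cres n x * cres m x) \<le> 2 * L\<^sup>2 * (2 * ?\<theta> ^ Suc d) * (V n * V m)"
      by (rule order_trans[rotated])
    also have "\<dots> = 4 * L\<^sup>2 * (?\<theta> ^ Suc d * (V n * V m))" by (simp add: mult.assoc)
    finally show ?thesis unfolding e .
  qed
  consider "n < m" | "m < n" | "n = m" by linarith
  thus ?thesis
  proof cases
    case 1
    thus ?thesis by (rule lt)
  next
    case 2
    from lt[OF this] show ?thesis by (simp add: mult.commute abs_minus_commute)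
  next
    case 3
    have "expectation (\<lambda>x. cres n x * cres m x) \<le> expectation (\<lambda>_. (2 * L * V n) * (2 * L * V m))"
    proof (intro integral_mono cres_prod_integrable)
      fix x assume "x \<in> space \<mu>"
      thus "cres n x * cres m x \<le> (2 * L * V n) * (2 * L * V m)" using cres_prod_bound[of x n m] by simp
    qed simp
    thus ?thesis using 3 prob_space by (simp add: power2_eq_square mult_ac)
  qed
qed

text \<open>Schur's test with \<theta> = 1 - 1/L contributes 2 L, which turns 4 L^2 into 8
  L^3.\<close>

lemma L2_norm_cres_sum:
  assumes A: "finite A"
  shows "expectation (\<lambda>x. (\<Sum>n\<in>A. cres n x)\<^sup>2) \<le> 8 * L ^ 3 * (\<Sum>n\<in>A. (V n)\<^sup>2)"
proof -
  have "expectation (\<lambda>x. (\<Sum>n\<in>A. cres n x)\<^sup>2) = expectation (\<lambda>x. \<Sum>n\<in>A. \<Sum>m\<in>A. cres n x * cres m x)"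
    by (simp add: power2_eq_square sum_product)
  also have "\<dots> = (\<Sum>n\<in>A. \<Sum>m\<in>A. expectation (\<lambda>x. cres n x * cres m x))"
    by (simp add: cres_prod_integrable)
  also have "\<dots> \<le> (\<Sum>n\<in>A. \<Sum>m\<in>A. 4 * L\<^sup>2 * ((1 - 1 / L) ^ nat \<bar>int n - int m\<bar> * (V n * V m)))"
    by (intro sum_mono correlation)
  also have "\<dots> = 4 * L\<^sup>2 * (\<Sum>n\<in>A. \<Sum>m\<in>A. (1 - 1 / L) ^ nat \<bar>int n - int m\<bar> * (V n * V m))"
    by (simp only: sum_distrib_left)
  also have "\<dots> \<le> 4 * L\<^sup>2 * (2 / (1 - (1 - 1 / L)) * (\<Sum>n\<in>A. (V n)\<^sup>2))"
    using L_ge by (intro mult_left_mono geometric_quadratic_form_le A) auto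
  also have "\<dots> = 8 * L ^ 3 * (\<Sum>n\<in>A. (V n)\<^sup>2)" by (simp add: power2_eq_square power3_eq_cube)
  finally show ?thesis .
qed

lemma cres_sum_AE_convergent:
  assumes "summable (\<lambda>n. (V n)\<^sup>2)"
  shows "\<exists>r. strict_mono r \<and> (AE x in \<mu>. convergent (\<lambda>i. \<Sum>n<r i. cres n x))"
proof (rule L2_Cauchy_imp_AE_convergent_subseq)
  have int: "integrable \<mu> (\<lambda>x. (\<Sum>n\<in>A. cres n x)\<^sup>2)" for A
    unfolding power2_eq_square sum_product by (intro Bochner_Integration.integrable_sum cres_prod_integrable)
  have diff: "(\<Sum>n<m. cres n x) - (\<Sum>n<k. cres n x) = (\<Sum>n\<in>{k..<m}. cres n x)" if "k \<le> m" for k m x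
    using sum_diff_nat_ivl[of 0 k m "\<lambda>n. cres n x"] that by (simp add: lessThan_atLeast0)
  show "integrable \<mu> (\<lambda>x. ((\<Sum>n<m. cres n x) - (\<Sum>n<k. cres n x))\<^sup>2)" for k m
  proof (cases "k \<le> m")
    case True
    thus ?thesis using int by (simp add: diff)
  next
    case False
    have "(\<lambda>x. ((\<Sum>n<m. cres n x) - (\<Sum>n<k. cres n x))\<^sup>2) = (\<lambda>x. ((\<Sum>n<k. cres n x) - (\<Sum>n<m. cres n x))\<^sup>2)"
      by (simp add: power2_commute)
    thus ?thesis using int False by (simp add: diff)
  qed
  fix \<epsilon> :: real assume \<epsilon>: "0 < \<epsilon>"
  have L3: "0 < 8 * L ^ 3" using L_ge by simp
  obtain N where N: "\<And>m n. N \<le> m \<Longrightarrow> norm (\<Sum>k=m..<n. (V k)\<^sup>2) < \<epsilon> / (8 * L ^ 3)"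
    using assms[unfolded summable_Cauchy] \<epsilon> L3 by (meson divide_pos_pos)
  show "\<exists>N. \<forall>n\<ge>N. \<forall>m\<ge>n. expectation (\<lambda>x. ((\<Sum>n<m. cres n x) - (\<Sum>n<n. cres n x))\<^sup>2) \<le> \<epsilon>"
  proof (intro exI[of _ N] allI impI)
    fix k m assume k: "N \<le> k" "k \<le> m"
    have "expectation (\<lambda>x. ((\<Sum>n<m. cres n x) - (\<Sum>n<k. cres n x))\<^sup>2) = expectation (\<lambda>x. (\<Sum>n\<in>{k..<m}. cres n x)\<^sup>2)"
      using k(2) by (simp add: diff)
    also have "\<dots> \<le> 8 * L ^ 3 * (\<Sum>n=k..<m. (V n)\<^sup>2)" by (rule L2_norm_cres_sum) simp
    also have "\<dots> \<le> 8 * L ^ 3 * (\<epsilon> / (8 * L ^ 3))"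
      using N[OF k(1), of m] L3 by (intro mult_left_mono) auto
    finally show "expectation (\<lambda>x. ((\<Sum>n<m. cres n x) - (\<Sum>n<k. cres n x))\<^sup>2) \<le> \<epsilon>" using L3 by simp
  qed
qed measurable

text \<open>The character ignores the integers removed in \<open>res\<close>, so rotating by the
  accumulated means leaves exactly the sum of centred residues in the phase.\<close>

lemma approx_eq_cres:
  assumes x: "x \<in> X"
  shows "unit_char (\<Sum>n<N. expectation (res n)) * approx N x = approx 0 x * unit_char (- (\<Sum>n<N. cres n x))"
proof (induction N)
  case (Suc N)
  have "unit_char (- (\<alpha> * real (step N x))) = unit_char (- res N x)"
    unfolding res_def using unit_char_diff_round[of "\<alpha> * real (step N x)"] by (simp only: unit_char_uminus)
  hence "unit_char (\<Sum>n<Suc N. expectation (res n)) * approx (Suc N) x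
      = (unit_char (\<Sum>n<N. expectation (res n)) * approx N x) * (unit_char (expectation (res N)) * unit_char (- res N x))"
    using approx_step[OF x, of N] by (simp add: unit_char_add mult_ac)
  also have "unit_char (expectation (res N)) * unit_char (- res N x) = unit_char (- cres N x)"
    by (simp add: cres_def flip: unit_char_add)
  finally show ?case unfolding Suc by (simp add: mult.assoc flip: unit_char_add)
qed simp

lemma summable_imp_L2_eigenvalue:
  assumes "summable (\<lambda>n. (V n)\<^sup>2)" shows "L2_eigenvalue \<mu> T (unit_char \<alpha>)"
proof -
  obtain r where r: "strict_mono r" "AE x in \<mu>. convergent (\<lambda>i. \<Sum>n<r i. cres n x)"
    using cres_sum_AE_convergent[OF assms] by blast
  let ?\<kappa> = "\<lambda>i. unit_char (\<Sum>n<r i. expectation (res n))"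
  \<comment> \<open>Taking \<open>lim\<close> everywhere makes f measurable and equal to the limit
    wherever one exists, as \<open>AE_eigen_limit\<close> asks; its default value is met only on a
    null set.\<close>
  define f where "f x = lim (\<lambda>i. ?\<kappa> i * approx (r i) x)" for x
  have fm: "f \<in> borel_measurable \<mu>" unfolding f_def by measurable
  have lim: "AE x in \<mu>. (\<lambda>i. ?\<kappa> i * approx (r i) x) \<longlonglongrightarrow> f x"
    using r(2) AE_space
  proof eventually_elim
    case (elim x)
    obtain y where y: "(\<lambda>i. \<Sum>n<r i. cres n x) \<longlonglongrightarrow> y" using elim(1) by (auto simp: convergent_def)
    have "(\<lambda>i. approx 0 x * unit_char (- (\<Sum>n<r i. cres n x))) \<longlonglongrightarrow> approx 0 x * unit_char (- y)"
      unfolding unit_char_def using y by (intro tendsto_intros)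
    hence "(\<lambda>i. ?\<kappa> i * approx (r i) x) \<longlonglongrightarrow> approx 0 x * unit_char (- y)"
      using elim(2) by (simp add: approx_eq_cres)
    thus ?case unfolding f_def by (simp add: limI)
  qed
  have "AE x in \<mu>. norm (f x) = 1"
    using lim
  proof eventually_elim
    case (elim x)
    from tendsto_norm[OF this] show ?case by (simp add: norm_mult approx_def LIMSEQ_const_iff)
  qed
  moreover have "AE x in \<mu>. f (T x) = unit_char \<alpha> * f x"
    by (rule AE_eigen_limit[OF lim r(1)]) (simp add: f_def limI)
  ultimately show ?thesis
    unfolding L2_eigenvalue_def using fm norm_one_eigenfunction[OF fm] by blast
qed

end

theorem theorem1:
  fixes X :: "'a::metric_space set" and T Ti :: "'a \<Rightarrow> 'a"
    and C :: "nat \<Rightarrow> nat" and B :: "nat \<Rightarrow> nat \<Rightarrow> 'a set" and h :: "nat \<Rightarrow> nat \<Rightarrow> nat"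
    and \<mu> :: "'a measure" and \<alpha> :: real
  assumes "minimal_cantor_system X T Ti"
    and "KR_sequence X T C B h"
    and "linearly_recurrent_seq C h"
    and "invariant_prob X T \<mu>"
  shows "(L2_eigenvalue \<mu> T (exp (2 * \<i> * pi * complex_of_real \<alpha>)) \<longleftrightarrow>
           summable (\<lambda>n. (vnorm (C (n + 2)) (\<lambda>l. \<alpha> * PH1 X T C B h (n + 2) l))\<^sup>2))
       \<and> (continuous_eigenvalue X \<mu> T (exp (2 * \<i> * pi * complex_of_real \<alpha>)) \<longleftrightarrow>
           summable (\<lambda>n. vnorm (C (n + 2)) (\<lambda>l. \<alpha> * PH1 X T C B h (n + 2) l)))"
proof -
  obtain L0 :: real where L0: "\<And>n l k. 1 \<le> n \<Longrightarrow> l \<in> {1..C n} \<Longrightarrow> k \<in> {1..C (n - 1)} \<Longrightarrow>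
      real (h n l) \<le> L0 * real (h (n - 1) k)"
    using assms(3) unfolding linearly_recurrent_seq_def by blast
  \<comment> \<open>Raising the constant to at least 2 preserves linear recurrence and puts the
    contraction factor 1 - 1/L in [1/2, 1).\<close>
  have "real (h (Suc n) l) \<le> max 2 L0 * real (h n k)" if "l \<in> {1..C (Suc n)}" "k \<in> {1..C n}" for n l k
  proof -
    have "real (h (Suc n) l) \<le> L0 * real (h n k)" using L0[of "Suc n" l k] that by simp
    also have "\<dots> \<le> max 2 L0 * real (h n k)" by (intro mult_right_mono) auto
    finally show ?thesis .
  qed
  then interpret kr_measure X T Ti C B h "max 2 L0" \<alpha> \<mu>
    using assms by unfold_locales auto
  have e: "exp (2 * \<i> * pi * complex_of_real \<alpha>) = unit_char \<alpha>"
    by (simp add: unit_char_def cis_conv_exp mult_ac)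
  \<comment> \<open>The series of the theorem start at level 2; the two missing terms do not affect
    summability.\<close>
  have "L2_eigenvalue \<mu> T (unit_char \<alpha>) \<longleftrightarrow> summable (\<lambda>n. (V (n + 2))\<^sup>2)"
    unfolding summable_iff_shift[of "\<lambda>n. (V n)\<^sup>2" 2]
    using L2_eigenvalue_imp_summable summable_imp_L2_eigenvalue by blast
  moreover have "continuous_eigenvalue X \<mu> T (unit_char \<alpha>) \<longleftrightarrow> summable (\<lambda>n. V (n + 2))"
    unfolding summable_iff_shift[of V 2]
    using continuous_eigenvalue_imp_summable summable_imp_continuous_eigenvalue by blast
  ultimately show ?thesis unfolding e vnorm_PH1 by blast
qed

end
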